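(* For all positive integers $n$ and $k$, there exists a $k$-antichain $A\subseteq[0,1]^n$ such that $\mathcal H^{n-1}(A)=kn$.
   Context: For $\mathbf x,\mathbf y\in\mathbb R^n$, write $\mathbf x\le\mathbf y$ if $\mathbf x_i\le\mathbf y_i$ for all $i\in\{1,\ldots,n\}$ (pointwise order). For $S\subseteq\mathbb R^n$, a subset $C\subseteq S$ is a chain in $S$ if for all $\mathbf x,\mathbf y\in C$ one has $\mathbf x\le\mathbf y$ or $\mathbf y\le\mathbf x$. For a positive integer $k$, a $k$-antichain in $S$ is a subset $A\subseteq S$ such that $\operatorname{card}(A\cap C)\le k$ for every chain $C\subseteq S$. $\mathcal H^s$ denotes the normalized $s$-dimensional Hausdorff (outer) measure on $\mathbb R^n$: with Euclidean diameters, $\mathcal H^s(A)=\lim_{\delta\to0}\mathcal H^s_\delta(A)$, where $$\mathcal H^s_\delta(A)=\inf\left\{\sum_{j=1}^\infty \frac{\pi^{s/2}}{\Gamma(\frac s2+1)}\left(\frac{\operatorname{diam}C_j}{2}\right)^s: A\subseteq\bigcup_{j=1}^\infty C_j,\ \operatorname{diam}C_j\le\delta\right\}.$$ With this normalization $\mathcal H^m$ agrees with Lebesgue measure on Borel subsets of $\mathbb R^m$ for every positive integer $m$, and $\mathcal H^0$ is the counting measure. *)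

theory Defs
  imports "HOL-Analysis.Analysis"
begin

(* finite (A \<inter> C) is required because card of an infinite set is 0. *)
definition k_antichain :: "nat \<Rightarrow> 'a::order set \<Rightarrow> 'a set \<Rightarrow> bool" where
  "k_antichain k S A \<longleftrightarrow> A \<subseteq> S \<and>
     (\<forall>C. C \<subseteq> S \<and> Complete_Partial_Order.chain (\<le>) C \<longrightarrow> finite (A \<inter> C) \<and> card (A \<inter> C) \<le> k)"

(* unit_ball_vol s is pi powr (s/2) / Gamma (s/2 + 1) for every real s.  The case s = 0 is separate
   because 0 powr 0 = 0: a nonempty set then has weight 1 and the empty set weight 0, which makes
   the 0-dimensional measure the counting measure. *)
definition hausdorff_weight :: "real \<Rightarrow> 'a::metric_space set \<Rightarrow> ennreal" where
  "hausdorff_weight s C =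
     (if C = {} then 0
      else ennreal (unit_ball_vol s * (if s = 0 then 1 else (diameter C / 2) powr s)))"

(* diameter is real-valued and unspecified on unbounded sets; boundedness of the C j expresses
   that their diameters are finite. *)
definition hausdorff_pre :: "real \<Rightarrow> real \<Rightarrow> 'a::metric_space set \<Rightarrow> ennreal" where
  "hausdorff_pre s \<delta> A =
     (INF C \<in> {C :: nat \<Rightarrow> 'a set. A \<subseteq> (\<Union>j. C j) \<and> (\<forall>j. bounded (C j) \<and> diameter (C j) \<le> \<delta>)}.
        \<Sum>j. hausdorff_weight s (C j))"

definition hausdorff_measure :: "real \<Rightarrow> 'a::metric_space set \<Rightarrow> ennreal" where
  "hausdorff_measure s A = Lim (at_right 0) (\<lambda>\<delta>. hausdorff_pre s \<delta> A)"

lemma hausdorff_pre_antimono: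
  assumes "\<delta> \<le> \<epsilon>"
  shows "hausdorff_pre s \<epsilon> A \<le> hausdorff_pre s \<delta> A"
  unfolding hausdorff_pre_def using assms by (intro INF_superset_mono) (auto intro: order_trans)

(* The limit in the definition always exists. *)
lemma hausdorff_pre_tendsto:
  "((\<lambda>\<delta>. hausdorff_pre s \<delta> A) \<longlongrightarrow> (SUP \<delta>\<in>{0<..}. hausdorff_pre s \<delta> A)) (at_right 0)"
proof (rule increasing_tendsto)
  show "\<forall>\<^sub>F \<delta> in at_right 0. hausdorff_pre s \<delta> A \<le> (SUP \<delta>\<in>{0<..}. hausdorff_pre s \<delta> A)"
    by (auto simp: eventually_at_right_less intro!: SUP_upper eventually_mono[OF eventually_at_right_less])
next
  fix x assume "x < (SUP \<delta>\<in>{0<..}. hausdorff_pre s \<delta> A)"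
  then obtain \<epsilon> where \<epsilon>: "\<epsilon> > 0" "x < hausdorff_pre s \<epsilon> A"
    by (auto simp: less_SUP_iff)
  have "\<forall>\<^sub>F \<delta> in at_right 0. \<delta> < \<epsilon>"
    using \<epsilon>(1) by (auto simp: eventually_at_right_field)
  then show "\<forall>\<^sub>F \<delta> in at_right 0. x < hausdorff_pre s \<delta> A"
    by eventually_elim (meson \<epsilon>(2) hausdorff_pre_antimono less_le_trans less_imp_le)
qed

lemma hausdorff_measure_eq_SUP:
  "hausdorff_measure s A = (SUP \<delta>\<in>{0<..}. hausdorff_pre s \<delta> A)"
  unfolding hausdorff_measure_def
  by (rule tendsto_Lim[OF _ hausdorff_pre_tendsto]) simp

end

theory Submission
  imports Defs
begin

text \<open>Write \<open>n\<close> for \<^term>\<open>CARD('n)\<close>. The points \<open>(f y\<^sub>1, \<dots>, f y\<^sub>n)\<close> with \<open>y\<^sub>1 + \<dots> + y\<^sub>n = c\<close>,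
where \<open>f\<close> is strictly increasing with values in the unit interval, form an antichain of the cube, and \<open>k\<close>
values of \<open>c\<close> give a \<open>k\<close>-antichain. Choose \<open>f\<close> (the function \<open>mix\<close>) continuous and singular: up to
arbitrarily small measure, the values of \<open>f\<close> are taken on very thin compact sets \<open>Z\<close> (the sets
\<open>carrier_set\<close>). Then for each direction \<open>i\<close> the part of the level set on which all coordinates other
than the \<open>i\<close>-th are in \<open>f ` Z\<close> projects along \<open>i\<close> onto almost all of the facet, because the \<open>i\<close>-th
coordinate can always be solved for. If \<open>c\<close> is no sum of \<open>n\<close> elements of \<open>Z\<close>, the \<open>n\<close> parts are
disjoint, so each level set has measure at least \<open>n\<close>. Such \<open>c\<close> are plentiful as \<open>Z\<close> is built from a
Cantor set so thin that its \<open>n\<close>-fold sumset is null.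

The lower bound is \<open>hausdorff_measure_level_sets_ge\<close>. Since Hausdorff measure carries the normalization of
Lebesgue measure, it needs the sharp isodiametric inequality: a set of diameter \<open>d\<close> in dimension \<open>m\<close>
has measure at most that of a ball of diameter \<open>d\<close>. Steiner symmetrization in all coordinate directions
proves it (\<open>isodiametric_PiM\<close>). Instead of measuring \<open>f ` Z\<close>, the parts are mapped by a
1-Lipschitz map onto a full cube of side \<open>1 - 2\<^sup>-\<^sup>p\<close> (\<open>piece_cover_ge\<close>).

The exact value comes from truncation. Let \<open>A\<close> be the union of the level sets, and cut it by
\<open>x\<^sub>a - x\<^sub>b \<le> t\<close>. An antichain is a Lipschitz graph along the direction
\<open>(1, \<dots>, 1)\<close>, and this direction is parallel to the cutting hyperplanes; hence a slab
\<open>s < x\<^sub>a - x\<^sub>b \<le> t\<close> meets it in measure \<open>O(t - s)\<close>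
(\<open>hausdorff_measure_antichain_slab_le\<close>). So the measure of the truncated set depends continuously on
\<open>t\<close>, starts at \<open>0\<close> and ends at \<open>k n\<close> or above, and takes the value \<open>k n\<close> at some
\<open>t\<close>. Subsets of \<open>k\<close>-antichains are \<open>k\<close>-antichains. In dimension 1 there are no two directions to
compare, but any \<open>k\<close> points will do.\<close>

section \<open>The isodiametric inequality by Steiner symmetrization\<close>

text \<open>The one-dimensional core of the fact that symmetrization does not increase diameters: if \<open>S\<close> spans
\<open>[a, b]\<close>, then \<open>T\<close> is confined to \<open>[b - r, a + r]\<close>.\<close>
lemma emeasure_add_le_of_mutual_distance:
  fixes S T :: "real set"
  assumes "S \<noteq> {}" "T \<noteq> {}" and r: "\<And>s t. s \<in> S \<Longrightarrow> t \<in> T \<Longrightarrow> \<bar>s - t\<bar> \<le> r"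
  shows "emeasure lborel S + emeasure lborel T \<le> ennreal (2 * r)"
proof -
  obtain s0 t0 where s0: "s0 \<in> S" and t0: "t0 \<in> T" using assms by blast
  define a b where "a = Inf S" and "b = Sup S"
  have bdd: "bdd_above S" "bdd_below S"
  proof -
    show "bdd_above S" using r[OF _ t0] by (intro bdd_aboveI[of _ "t0 + r"]) force
    show "bdd_below S" using r[OF _ t0] by (intro bdd_belowI[of _ "t0 - r"]) force
  qed
  have S: "S \<subseteq> {a..b}" using bdd by (auto simp: a_def b_def intro: cInf_lower cSup_upper)
  have T: "T \<subseteq> {b - r..a + r}"
  proof
    fix t assume t: "t \<in> T"
    have "b \<le> t + r" unfolding b_def using r[OF _ t] assms(1) by (intro cSup_least) force+
    moreover have "t - r \<le> a" unfolding a_def using r[OF _ t] assms(1) by (intro cInf_greatest) force+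
    ultimately show "t \<in> {b - r..a + r}" by auto
  qed
  have le: "a \<le> b" "b - r \<le> a + r" using S s0 T t0 by force+
  have "emeasure lborel S + emeasure lborel T \<le> ennreal (b - a) + ennreal (a + r - (b - r))"
    using emeasure_mono[OF S, of lborel] emeasure_mono[OF T, of lborel] le
    by (intro add_mono) auto
  also have "\<dots> = ennreal (2 * r)" using le by (subst ennreal_plus[symmetric]) auto
  finally show ?thesis .
qed

lemma emeasure_centred_interval:
  "emeasure lborel {y::real. ennreal (2 * \<bar>y\<bar>) < m} = m"
proof (cases m)
  case (real x)
  have "{y::real. ennreal (2 * \<bar>y\<bar>) < m} = {-(x/2)<..<x/2}"
    using real by (auto simp: ennreal_less_iff abs_if split: if_splits)
  then show ?thesis using real by simp
next
  case top
  then show ?thesis by (simp add: ennreal_less_top)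
qed

text \<open>Steiner symmetrization in direction \<open>i\<close>: each line parallel to that axis meets the new set in the
centred open interval with the length of the old slice. With a strict inequality, lines whose slice is null
disappear, which costs no measure and avoids the possibly non-measurable projection of \<open>A\<close>; it also makes
every slice that survives nonempty.\<close>
definition steiner :: "'i set \<Rightarrow> 'i \<Rightarrow> ('i \<Rightarrow> real) set \<Rightarrow> ('i \<Rightarrow> real) set" where
  "steiner I i A = {x \<in> I \<rightarrow>\<^sub>E UNIV. ennreal (2 * \<bar>x i\<bar>) < emeasure lborel {t. x(i := t) \<in> A}}"

text \<open>On functions restricted to \<open>I\<close> the Euclidean distance is not the metric of any type class, so the diameter
bound is spelled out, squared.\<close>
definition diam_le :: "'i set \<Rightarrow> real \<Rightarrow> ('i \<Rightarrow> real) set \<Rightarrow> bool" where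
  "diam_le I d A \<longleftrightarrow> (\<forall>x\<in>A. \<forall>y\<in>A. (\<Sum>j\<in>I. (x j - y j)\<^sup>2) \<le> d\<^sup>2)"

lemma diam_leD: "diam_le I d A \<Longrightarrow> x \<in> A \<Longrightarrow> y \<in> A \<Longrightarrow> (\<Sum>j\<in>I. (x j - y j)\<^sup>2) \<le> d\<^sup>2"
  by (auto simp: diam_le_def)

definition mirror_symmetric :: "'i \<Rightarrow> ('i \<Rightarrow> real) set \<Rightarrow> bool" where
  "mirror_symmetric j A \<longleftrightarrow> (\<forall>x\<in>A. x(j := - x j) \<in> A)"

lemma measurable_coordinate_update:
  assumes "i \<in> I"
  shows "(\<lambda>(x, t). x(i := t)) \<in> (\<Pi>\<^sub>M j\<in>I. lborel) \<Otimes>\<^sub>M lborel \<rightarrow>\<^sub>M (\<Pi>\<^sub>M j\<in>I. (lborel :: real measure))"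
proof -
  have "(\<lambda>p. (fst p)(i := snd p)) \<in> (\<Pi>\<^sub>M j\<in>I. lborel) \<Otimes>\<^sub>M lborel \<rightarrow>\<^sub>M (\<Pi>\<^sub>M j\<in>I. (lborel :: real measure))"
    using assms by (intro measurable_fun_upd[where J=I]) auto
  then show ?thesis by (simp add: case_prod_unfold)
qed

text \<open>By Tonelli, with the \<open>i\<close>-th coordinate as the inner variable, it suffices that corresponding slices have
equal length.\<close>
lemma
  fixes A :: "('i \<Rightarrow> real) set"
  assumes I: "finite I" "i \<in> I" and A: "A \<in> sets (\<Pi>\<^sub>M j\<in>I. lborel)"
  shows steiner_measurable: "steiner I i A \<in> sets (\<Pi>\<^sub>M j\<in>I. lborel)"
    and emeasure_steiner: "emeasure (\<Pi>\<^sub>M j\<in>I. lborel) (steiner I i A) = emeasure (\<Pi>\<^sub>M j\<in>I. lborel) A"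
proof -
  let ?M = "\<lambda>I :: 'i set. \<Pi>\<^sub>M j\<in>I. (lborel :: real measure)"
  interpret product_sigma_finite "\<lambda>_::'i. lborel :: real measure" by standard
  note [measurable] = A measurable_coordinate_update[OF I(2)]
  have [measurable]: "{t. x(i := t) \<in> A} \<in> sets lborel" if "x \<in> space (?M I)" for x
  proof -
    have "(\<lambda>t. (\<lambda>(x, t). x(i := t)) (x, t)) \<in> lborel \<rightarrow>\<^sub>M ?M I"
      using that by measurable
    then have "(\<lambda>t. x(i := t)) \<in> lborel \<rightarrow>\<^sub>M ?M I" by simp
    from measurable_sets[OF this A] show ?thesis by (simp add: vimage_def)
  qed
  have "(\<lambda>x. \<integral>\<^sup>+t. indicator A ((\<lambda>(x, t). x(i := t)) (x, t)) \<partial>lborel) \<in> borel_measurable (?M I)"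
    by measurable
  also have "?this \<longleftrightarrow> (\<lambda>x. emeasure lborel {t. x(i := t) \<in> A}) \<in> borel_measurable (?M I)"
  proof (rule measurable_cong)
    fix x assume "x \<in> space (?M I)"
    then have "{t. x(i := t) \<in> A} \<in> sets lborel" by measurable
    then have "emeasure lborel {t. x(i := t) \<in> A} = (\<integral>\<^sup>+t. indicator {t. x(i := t) \<in> A} t \<partial>lborel)"
      by simp
    then show "(\<integral>\<^sup>+t. indicator A ((\<lambda>(x, t). x(i := t)) (x, t)) \<partial>lborel) = emeasure lborel {t. x(i := t) \<in> A}"
      by (simp add: indicator_def)
  qed
  finally have [measurable]: "(\<lambda>x. emeasure lborel {t. x(i := t) \<in> A}) \<in> borel_measurable (?M I)" .
  have "steiner I i A = {x \<in> space (?M I). ennreal (2 * \<bar>x i\<bar>) < emeasure lborel {t. x(i := t) \<in> A}}"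
    by (simp add: steiner_def space_PiM)
  also have "\<dots> \<in> sets (?M I)" using I by measurable
  finally show st: "steiner I i A \<in> sets (?M I)" .

  define J where "J = I - {i}"
  have J: "finite J" "i \<notin> J" "insert i J = I" using I by (auto simp: J_def)
  have slices: "emeasure (?M I) B = (\<integral>\<^sup>+x. emeasure lborel {t. x(i := t) \<in> B} \<partial>?M J)"
    if B: "B \<in> sets (?M I)" for B
  proof -
    have "emeasure (?M I) B = (\<integral>\<^sup>+x. indicator B x \<partial>?M (insert i J))" using B J by simp
    also have "\<dots> = (\<integral>\<^sup>+x. (\<integral>\<^sup>+t. indicator B (x(i := t)) \<partial>lborel) \<partial>?M J)"
      using B J by (subst product_nn_integral_insert) auto
    also have "\<dots> = (\<integral>\<^sup>+x. emeasure lborel {t. x(i := t) \<in> B} \<partial>?M J)"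
    proof (rule nn_integral_cong)
      fix x assume x: "x \<in> space (?M J)"
      have "(\<lambda>t. x(i := t)) \<in> lborel \<rightarrow>\<^sub>M ?M (insert i J)"
        by (rule measurable_component_update[OF x J(2)])
      from measurable_sets[OF this, of B] B J(3) have "{t. x(i := t) \<in> B} \<in> sets lborel"
        by (simp add: vimage_def)
      then have "emeasure lborel {t. x(i := t) \<in> B} = (\<integral>\<^sup>+t. indicator {t. x(i := t) \<in> B} t \<partial>lborel)"
        by simp
      then show "(\<integral>\<^sup>+t. indicator B (x(i := t)) \<partial>lborel) = emeasure lborel {t. x(i := t) \<in> B}"
        by (simp add: indicator_def)
    qed
    finally show ?thesis .
  qed
  show "emeasure (?M I) (steiner I i A) = emeasure (?M I) A"
    unfolding slices[OF st] slices[OF A]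
  proof (rule nn_integral_cong)
    fix x assume x: "x \<in> space (?M J)"
    have "{t. x(i := t) \<in> steiner I i A} = {t. ennreal (2 * \<bar>t\<bar>) < emeasure lborel {t. x(i := t) \<in> A}}"
      using x J I by (auto simp: steiner_def space_PiM PiE_def extensional_def)
    then show "emeasure lborel {t. x(i := t) \<in> steiner I i A} = emeasure lborel {t. x(i := t) \<in> A}"
      by (simp add: emeasure_centred_interval)
  qed
qed

text \<open>Two points of the symmetrized set differ in coordinate \<open>i\<close> by less than half the total length of their
slices, while the distances between points of the two slices of \<open>A\<close> have at least that half as their
supremum.\<close>
lemma diam_le_steiner:
  assumes I: "finite I" "i \<in> I" and A: "diam_le I d A"
  shows "diam_le I d (steiner I i A)"
  unfolding diam_le_def
proof (intro ballI)
  fix x y assume x: "x \<in> steiner I i A" and y: "y \<in> steiner I i A"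
  define S T where "S = {t. x(i := t) \<in> A}" and "T = {t. y(i := t) \<in> A}"
  \<comment> \<open>\<open>c\<close> is the part of the squared distance that the symmetrization leaves unchanged.\<close>
  define c where "c = (\<Sum>j\<in>I - {i}. (x j - y j)\<^sup>2)"
  have xS: "ennreal (2 * \<bar>x i\<bar>) < emeasure lborel S" and yT: "ennreal (2 * \<bar>y i\<bar>) < emeasure lborel T"
    using x y by (auto simp: steiner_def S_def T_def)
  then have ne: "S \<noteq> {}" "T \<noteq> {}" by auto
  have st: "(s - t)\<^sup>2 + c \<le> d\<^sup>2" if "s \<in> S" "t \<in> T" for s t
  proof -
    have "(\<Sum>j\<in>I. ((x(i := s)) j - (y(i := t)) j)\<^sup>2) \<le> d\<^sup>2"
      using diam_leD[OF A, of "x(i := s)" "y(i := t)"] that by (simp add: S_def T_def)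
    also have "(\<Sum>j\<in>I. ((x(i := s)) j - (y(i := t)) j)\<^sup>2) = (s - t)\<^sup>2 + c"
      using I by (subst sum.remove[of _ i]) (auto simp: c_def intro!: sum.cong)
    finally show ?thesis .
  qed
  obtain s0 t0 where "s0 \<in> S" "t0 \<in> T" using ne by blast
  with st[OF this] have c: "c \<le> d\<^sup>2"
    by (meson add_le_same_cancel2 order_trans zero_le_power2 le_add_same_cancel2)
  have "emeasure lborel S + emeasure lborel T \<le> ennreal (2 * sqrt (d\<^sup>2 - c))"
  proof (rule emeasure_add_le_of_mutual_distance[OF ne])
    fix s t assume "s \<in> S" "t \<in> T"
    from st[OF this] show "\<bar>s - t\<bar> \<le> sqrt (d\<^sup>2 - c)" by (intro real_le_rsqrt) auto
  qed
  moreover have "ennreal (2 * \<bar>x i\<bar> + 2 * \<bar>y i\<bar>) \<le> emeasure lborel S + emeasure lborel T"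
    using xS yT by (subst ennreal_plus) (auto intro!: add_mono)
  ultimately have "ennreal (2 * \<bar>x i\<bar> + 2 * \<bar>y i\<bar>) \<le> ennreal (2 * sqrt (d\<^sup>2 - c))" by (rule order_trans[rotated])
  then have "\<bar>x i\<bar> + \<bar>y i\<bar> \<le> sqrt (d\<^sup>2 - c)" using c by (subst (asm) ennreal_le_iff) auto
  then have "\<bar>x i - y i\<bar> \<le> sqrt (d\<^sup>2 - c)" by linarith
  then have "\<bar>x i - y i\<bar>\<^sup>2 \<le> (sqrt (d\<^sup>2 - c))\<^sup>2" by (intro power_mono) auto
  then have "(x i - y i)\<^sup>2 + c \<le> d\<^sup>2" using c by simp
  then show "(\<Sum>j\<in>I. (x j - y j)\<^sup>2) \<le> d\<^sup>2"
    using I by (subst sum.remove[of _ i]) (auto simp: c_def)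
qed

lemma mirror_symmetric_steiner_same:
  assumes "i \<in> I"
  shows "mirror_symmetric i (steiner I i A)"
  using assms by (auto simp: mirror_symmetric_def steiner_def PiE_def extensional_def)

text \<open>Symmetries gained in earlier steps persist: two points that are mirror images in direction \<open>j\<close> have the
same slice in direction \<open>i\<close>.\<close>
lemma mirror_symmetric_steiner_other:
  assumes "j \<in> I" "j \<noteq> i" and sym: "mirror_symmetric j A"
  shows "mirror_symmetric j (steiner I i A)"
  unfolding mirror_symmetric_def
proof
  fix x assume x: "x \<in> steiner I i A"
  have flip: "z(j := - z j) \<in> A \<longleftrightarrow> z \<in> A" for z
    using sym by (force simp: mirror_symmetric_def dest: bspec[of A _ "z(j := - z j)"])
  have "(x(j := - x j))(i := t) \<in> A \<longleftrightarrow> x(i := t) \<in> A" for t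
    using flip[of "x(i := t)"] assms(2) by (simp add: fun_upd_twist)
  then show "x(j := - x j) \<in> steiner I i A"
    using x assms(1,2) by (auto simp: steiner_def PiE_def extensional_def)
qed

lemma symmetrization:
  assumes I: "finite I" and J: "finite J" "J \<subseteq> I" and A: "A \<in> sets (\<Pi>\<^sub>M j\<in>I. lborel)" "diam_le I d A"
  shows "\<exists>B \<in> sets (\<Pi>\<^sub>M j\<in>I. lborel). emeasure (\<Pi>\<^sub>M j\<in>I. lborel) B = emeasure (\<Pi>\<^sub>M j\<in>I. lborel) A \<and>
           diam_le I d B \<and> (\<forall>j\<in>J. mirror_symmetric j B)"
  using J
proof (induction J rule: finite_induct)
  case empty
  then show ?case using A by auto
next
  case (insert i J)
  then obtain B where B: "B \<in> sets (\<Pi>\<^sub>M j\<in>I. lborel)" "emeasure (\<Pi>\<^sub>M j\<in>I. lborel) B = emeasure (\<Pi>\<^sub>M j\<in>I. lborel) A"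
      "diam_le I d B" "\<forall>j\<in>J. mirror_symmetric j B" by auto
  have i: "i \<in> I" using insert by auto
  have "\<forall>j\<in>insert i J. mirror_symmetric j (steiner I i B)"
    using insert.hyps insert.prems B(4) mirror_symmetric_steiner_same[OF i]
      mirror_symmetric_steiner_other[of _ I i B] by fast
  then show ?case
    using B steiner_measurable[OF I i B(1)] emeasure_steiner[OF I i B(1)] diam_le_steiner[OF I i B(3)]
    by (intro bexI[of _ "steiner I i B"]) auto
qed

lemma mirror_symmetric_all:
  assumes "finite J" "\<forall>j\<in>J. mirror_symmetric j B" "x \<in> B"
  shows "(\<lambda>j. if j \<in> J then - x j else x j) \<in> B"
  using assms
proof (induction J rule: finite_induct)
  case (insert i J)
  let ?x = "\<lambda>j. if j \<in> J then - x j else x j"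
  have "?x(i := - ?x i) \<in> B" using insert by (auto simp: mirror_symmetric_def)
  also have "?x(i := - ?x i) = (\<lambda>j. if j \<in> insert i J then - x j else x j)"
    using insert.hyps by auto
  finally show ?case .
qed simp

text \<open>After symmetrization in all directions the set is symmetric about the origin, so a point and its negative are at
distance at most \<open>d\<close>: the set lies in the ball of radius \<open>d / 2\<close>.\<close>
theorem isodiametric_PiM:
  assumes I: "finite I" and A: "A \<in> sets (\<Pi>\<^sub>M j\<in>I. lborel)" "diam_le I d A" and d: "d > 0"
  shows "emeasure (\<Pi>\<^sub>M j\<in>I. lborel) A \<le> ennreal (unit_ball_vol (card I) * (d / 2) ^ card I)"
proof -
  obtain B where B: "B \<in> sets (\<Pi>\<^sub>M j\<in>I. lborel)" "emeasure (\<Pi>\<^sub>M j\<in>I. lborel) B = emeasure (\<Pi>\<^sub>M j\<in>I. lborel) A"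
      "diam_le I d B" "\<forall>j\<in>I. mirror_symmetric j B"
    using symmetrization[OF I I order_refl A] by blast
  have "B \<subseteq> {f. sqrt (\<Sum>i\<in>I. (f i)\<^sup>2) \<le> d / 2} \<inter> space (\<Pi>\<^sub>M j\<in>I. lborel)"
  proof
    fix x assume x: "x \<in> B"
    let ?y = "\<lambda>j. if j \<in> I then - x j else x j"
    have "(\<Sum>j\<in>I. (x j - ?y j)\<^sup>2) \<le> d\<^sup>2"
      by (intro diam_leD[OF B(3)] x mirror_symmetric_all[OF I B(4) x])
    also have "(\<Sum>j\<in>I. (x j - ?y j)\<^sup>2) = 4 * (\<Sum>j\<in>I. (x j)\<^sup>2)"
      by (simp add: sum_distrib_left power2_eq_square algebra_simps)
    finally have "(\<Sum>j\<in>I. (x j)\<^sup>2) \<le> (d / 2)\<^sup>2" by (simp add: power_divide)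
    then have "sqrt (\<Sum>j\<in>I. (x j)\<^sup>2) \<le> d / 2"
      using d by (intro real_le_lsqrt) auto
    then show "x \<in> {f. sqrt (\<Sum>i\<in>I. (f i)\<^sup>2) \<le> d / 2} \<inter> space (\<Pi>\<^sub>M j\<in>I. lborel)"
      using x sets.sets_into_space[OF B(1)] by auto
  qed
  moreover have "{f. sqrt (\<Sum>i\<in>I. (f i)\<^sup>2) \<le> d / 2} \<inter> space (\<Pi>\<^sub>M j\<in>I. lborel) \<in> sets (\<Pi>\<^sub>M j\<in>I. lborel)"
    using I by (simp add: Collect_conj_eq[symmetric] Int_commute Int_def conj_commute)
  ultimately have "emeasure (\<Pi>\<^sub>M j\<in>I. lborel) B \<le>
      emeasure (\<Pi>\<^sub>M j\<in>I. lborel) ({f. sqrt (\<Sum>i\<in>I. (f i)\<^sup>2) \<le> d / 2} \<inter> space (\<Pi>\<^sub>M j\<in>I. lborel))"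
    by (rule emeasure_mono)
  with emeasure_cball_aux[OF I, of "d / 2"] d B(2) show ?thesis by simp
qed

definition hyperplane_point :: "'n \<Rightarrow> ('n \<Rightarrow> real) \<Rightarrow> real ^ 'n" where
  "hyperplane_point i y = (\<chi> j. if j = i then 0 else y j)"

lemma measurable_hyperplane_point [measurable]:
  "hyperplane_point i \<in> (\<Pi>\<^sub>M j\<in>-{i}. lborel) \<rightarrow>\<^sub>M (borel :: (real ^ 'n) measure)"
proof (rule borel_measurable_euclidean_space[THEN iffD2], rule ballI)
  fix b :: "real ^ 'n" assume "b \<in> Basis"
  then obtain k where b: "b = axis k 1" by (auto simp: Basis_vec_def)
  have "(\<lambda>y. if k = i then 0 else y k) \<in> (\<Pi>\<^sub>M j\<in>-{i}. lborel) \<rightarrow>\<^sub>M (borel :: real measure)"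
    by (cases "k = i") auto
  then show "(\<lambda>y. hyperplane_point i y \<bullet> b) \<in> (\<Pi>\<^sub>M j\<in>-{i}. lborel) \<rightarrow>\<^sub>M borel"
    by (simp add: b hyperplane_point_def inner_axis)
qed

lemma dist_hyperplane_point:
  "(dist (hyperplane_point i x) (hyperplane_point i y :: real ^ 'n))\<^sup>2 = (\<Sum>j\<in>-{i}. (x j - y j)\<^sup>2)"
proof -
  have "(dist (hyperplane_point i x) (hyperplane_point i y :: real ^ 'n))\<^sup>2 =
          (\<Sum>j\<in>UNIV. if j = i then 0 else (x j - y j)\<^sup>2)"
    by (auto simp: dist_norm norm_vec_def L2_set_def sum_nonneg hyperplane_point_def intro!: sum.cong)
  also have "\<dots> = (\<Sum>j\<in>-{i}. (x j - y j)\<^sup>2)"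
    by (intro sum.mono_neutral_cong_right) auto
  finally show ?thesis .
qed

text \<open>A bounded set has the same diameter as its closure, which is measurable; this turns the inequality for
measurable sets into one for arbitrary sets.\<close>
definition hyperplane_trace :: "'n \<Rightarrow> (real ^ 'n) set \<Rightarrow> ('n \<Rightarrow> real) set" where
  "hyperplane_trace i X = {y \<in> space (\<Pi>\<^sub>M j\<in>-{i}. (lborel :: real measure)). hyperplane_point i y \<in> closure X}"

lemma hyperplane_trace_measurable: "hyperplane_trace i X \<in> sets (\<Pi>\<^sub>M j\<in>-{i}. lborel)"
proof -
  let ?M = "\<Pi>\<^sub>M j\<in>-{i}. (lborel :: real measure)"
  have "hyperplane_point i -` closure X \<inter> space ?M \<in> sets ?M"
    by (rule measurable_sets[OF measurable_hyperplane_point]) auto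
  then show ?thesis by (simp add: hyperplane_trace_def Int_def vimage_def conj_commute)
qed

text \<open>The weight of a covering set is exactly the isodiametric bound in the coordinate hyperplane
\<open>x\<^sub>i = 0\<close>.\<close>
theorem isodiametric_hyperplane:
  fixes X :: "(real ^ 'n) set"
  assumes X: "bounded X"
  shows "emeasure (\<Pi>\<^sub>M j\<in>-{i}. lborel) (hyperplane_trace i X) \<le> hausdorff_weight (real CARD('n) - 1) X"
proof (cases "X = {}")
  case True
  then show ?thesis by (simp add: hyperplane_trace_def)
next
  case False
  let ?M = "\<Pi>\<^sub>M j\<in>-{i}. (lborel :: real measure)"
  define E where "E = hyperplane_trace i X"
  define d where "d = diameter X"
  define m where "m = card (-{i})"
  have m: "real CARD('n) - 1 = real m"
    by (simp add: m_def card_Diff_singleton Compl_eq_Diff_UNIV of_nat_diff Suc_leI)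
  have d0: "d \<ge> 0" unfolding d_def by (rule diameter_ge_0[OF X])
  have E: "E \<in> sets ?M" unfolding E_def by (rule hyperplane_trace_measurable)
  \<comment> \<open>The inequality in the product space requires a positive diameter bound; \<open>e\<close> takes care of \<open>d = 0\<close>.\<close>
  have bound: "emeasure ?M E \<le> ennreal (unit_ball_vol m * ((d + e) / 2) ^ m)" if e: "e > 0" for e
    unfolding m_def
  proof (rule isodiametric_PiM)
    show "diam_le (-{i}) (d + e) E"
      unfolding diam_le_def
    proof (intro ballI)
      fix x y assume "x \<in> E" "y \<in> E"
      then have "dist (hyperplane_point i x :: real ^ 'n) (hyperplane_point i y) \<le> diameter (closure X)"
        using X by (intro diameter_bounded_bound) (auto simp: E_def hyperplane_trace_def)
      also have "\<dots> \<le> d + e" using e by (simp add: d_def diameter_closure[OF X])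
      finally show "(\<Sum>j\<in>-{i}. (x j - y j)\<^sup>2) \<le> (d + e)\<^sup>2"
        unfolding dist_hyperplane_point[where 'n='n, symmetric] by (intro power_mono) auto
    qed
  qed (use E e d0 in auto)
  have "((\<lambda>e. ennreal (unit_ball_vol m * ((d + e) / 2) ^ m)) \<longlongrightarrow> ennreal (unit_ball_vol m * ((d + 0) / 2) ^ m)) (at_right 0)"
    by (intro tendsto_intros) simp
  then have "emeasure ?M E \<le> ennreal (unit_ball_vol m * ((d + 0) / 2) ^ m)"
    by (rule tendsto_lowerbound) (auto intro!: eventually_at_rightI[of 0 1] bound)
  also have "\<dots> = hausdorff_weight (real CARD('n) - 1) X"
    unfolding hausdorff_weight_def m using False d0 by (auto simp: d_def powr_realpow')
  finally show ?thesis by (simp add: E_def)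
qed

section \<open>Hausdorff measure\<close>

lemma hausdorff_pre_le_sum:
  assumes "A \<subseteq> (\<Union>j. C j)" "\<And>j. bounded (C j)" "\<And>j. diameter (C j) \<le> \<delta>"
  shows "hausdorff_pre s \<delta> A \<le> (\<Sum>j. hausdorff_weight s (C j))"
  unfolding hausdorff_pre_def using assms by (intro INF_lower) auto

lemma hausdorff_pre_greatest:
  assumes "\<And>C :: nat \<Rightarrow> 'a set. A \<subseteq> (\<Union>j. C j) \<Longrightarrow> \<forall>j. bounded (C j) \<and> diameter (C j) \<le> \<delta> \<Longrightarrow>
             v \<le> (\<Sum>j. hausdorff_weight s (C j))"
  shows "v \<le> hausdorff_pre s \<delta> (A :: 'a::metric_space set)"
  unfolding hausdorff_pre_def using assms by (intro INF_greatest) auto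

lemma hausdorff_weight_empty [simp]: "hausdorff_weight s {} = 0"
  by (simp add: hausdorff_weight_def)

lemma hausdorff_pre_le_measure: "\<delta> > 0 \<Longrightarrow> hausdorff_pre s \<delta> A \<le> hausdorff_measure s A"
  unfolding hausdorff_measure_eq_SUP by (intro SUP_upper) auto

lemma hausdorff_measure_least:
  "(\<And>\<delta>. \<delta> > 0 \<Longrightarrow> hausdorff_pre s \<delta> A \<le> v) \<Longrightarrow> hausdorff_measure s A \<le> v"
  unfolding hausdorff_measure_eq_SUP by (intro SUP_least) auto

lemma hausdorff_measure_mono:
  assumes "A \<subseteq> A'"
  shows "hausdorff_measure s A \<le> hausdorff_measure s A'"
proof (rule hausdorff_measure_least)
  fix \<delta> :: real assume "\<delta> > 0"
  have "hausdorff_pre s \<delta> A \<le> hausdorff_pre s \<delta> A'"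
    using assms by (intro hausdorff_pre_greatest hausdorff_pre_le_sum) auto
  also have "\<dots> \<le> hausdorff_measure s A'" by (rule hausdorff_pre_le_measure) fact
  finally show "hausdorff_pre s \<delta> A \<le> hausdorff_measure s A'" .
qed

lemma hausdorff_pre_le_finite_cover:
  fixes D :: "'b \<Rightarrow> 'a::metric_space set"
  assumes P: "finite P" and cov: "A \<subseteq> (\<Union>z\<in>P. D z)" and \<delta>: "\<delta> \<ge> 0"
    and D: "\<And>z. z \<in> P \<Longrightarrow> bounded (D z)" "\<And>z. z \<in> P \<Longrightarrow> diameter (D z) \<le> \<delta>"
    and w: "\<And>z. z \<in> P \<Longrightarrow> hausdorff_weight s (D z) \<le> w"
  shows "hausdorff_pre s \<delta> A \<le> of_nat (card P) * w"
proof -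
  obtain h where h: "bij_betw h {0..<card P} P" using ex_bij_betw_nat_finite[OF P] by blast
  define C where "C j = (if j < card P then D (h j) else {})" for j
  have hP: "h j \<in> P" if "j < card P" for j using h that by (auto simp: bij_betw_def)
  have "A \<subseteq> (\<Union>j. C j)"
  proof
    fix x assume "x \<in> A"
    then obtain z where z: "z \<in> P" "x \<in> D z" using cov by blast
    then have "z \<in> h ` {0..<card P}" using h by (simp add: bij_betw_def)
    then obtain j where "j < card P" "h j = z" by auto
    then show "x \<in> (\<Union>j. C j)" using z by (intro UN_I[of j]) (auto simp: C_def)
  qed
  then have "hausdorff_pre s \<delta> A \<le> (\<Sum>j. hausdorff_weight s (C j))"
    using D hP \<delta> by (intro hausdorff_pre_le_sum) (auto simp: C_def)
  also have "\<dots> = (\<Sum>j<card P. hausdorff_weight s (C j))"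
    by (rule suminf_finite) (auto simp: C_def)
  also have "\<dots> \<le> (\<Sum>j<card P. w)"
    using w hP by (intro sum_mono) (auto simp: C_def)
  finally show ?thesis by simp
qed

text \<open>Covers of the two sets are interleaved.\<close>
lemma hausdorff_pre_Un_le:
  "hausdorff_pre s \<delta> (A \<union> A') \<le> hausdorff_pre s \<delta> A + hausdorff_pre s \<delta> (A' :: 'a::metric_space set)"
proof -
  have two: "hausdorff_pre s \<delta> (A \<union> A') \<le> (\<Sum>j. hausdorff_weight s (C j)) + (\<Sum>j. hausdorff_weight s (C' j))"
    if C: "A \<subseteq> (\<Union>j. C j)" "\<forall>j. bounded (C j) \<and> diameter (C j) \<le> \<delta>"
    and C': "A' \<subseteq> (\<Union>j. C' j)" "\<forall>j. bounded (C' j) \<and> diameter (C' j) \<le> \<delta>"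
    for C C' :: "nat \<Rightarrow> 'a set"
  proof -
    define E where "E j = (if even j then C (j div 2) else C' (j div 2))" for j
    have E: "E (2 * j) = C j" "E (Suc (2 * j)) = C' j" for j by (auto simp: E_def)
    have "A \<union> A' \<subseteq> (\<Union>j. E j)"
    proof
      fix x assume "x \<in> A \<union> A'"
      then obtain j where "x \<in> C j \<or> x \<in> C' j" using C(1) C'(1) by blast
      then show "x \<in> (\<Union>j. E j)" using E[of j] by blast
    qed
    then have "hausdorff_pre s \<delta> (A \<union> A') \<le> (\<Sum>j. hausdorff_weight s (E j))"
      using C C' by (intro hausdorff_pre_le_sum) (auto simp: E_def)
    also have "\<dots> \<le> (\<Sum>j. hausdorff_weight s (C j)) + (\<Sum>j. hausdorff_weight s (C' j))"
    proof (rule suminf_le_const)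
      fix n
      have "(\<Sum>j<n. hausdorff_weight s (E j)) \<le> (\<Sum>j<2 * n. hausdorff_weight s (E j))"
        by (intro sum_mono2) auto
      also have "\<dots> = (\<Sum>j<n. hausdorff_weight s (C j)) + (\<Sum>j<n. hausdorff_weight s (C' j))"
        by (induction n) (simp_all add: E add_ac)
      also have "\<dots> \<le> (\<Sum>j. hausdorff_weight s (C j)) + (\<Sum>j. hausdorff_weight s (C' j))"
        by (intro add_mono sum_le_suminf) auto
      finally show "(\<Sum>j<n. hausdorff_weight s (E j)) \<le> \<dots>" .
    qed auto
    finally show ?thesis .
  qed
  have near: "\<exists>C. A \<subseteq> (\<Union>j. C j) \<and> (\<forall>j. bounded (C j) \<and> diameter (C j) \<le> \<delta>) \<and>
                (\<Sum>j. hausdorff_weight s (C j)) < hausdorff_pre s \<delta> A + ennreal e"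
    if "hausdorff_pre s \<delta> A < top" "e > 0" for A :: "'a set" and e :: real
  proof -
    have "hausdorff_pre s \<delta> A < hausdorff_pre s \<delta> A + ennreal e"
      using that by (cases "hausdorff_pre s \<delta> A") (auto simp: ennreal_plus[symmetric] ennreal_lessI simp del: ennreal_plus)
    then obtain C where "C \<in> {C. A \<subseteq> (\<Union>j. C j) \<and> (\<forall>j. bounded (C j) \<and> diameter (C j) \<le> \<delta>)}"
        "(\<Sum>j. hausdorff_weight s (C j)) < hausdorff_pre s \<delta> A + ennreal e"
      unfolding hausdorff_pre_def[of s \<delta> A] INF_less_iff by blast
    then show ?thesis by blast
  qed
  show ?thesis
  proof (rule ennreal_le_epsilon)
    fix e :: real assume fin: "hausdorff_pre s \<delta> A + hausdorff_pre s \<delta> A' < top" and e: "0 < e"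
    obtain C where C: "A \<subseteq> (\<Union>j. C j)" "\<forall>j. bounded (C j) \<and> diameter (C j) \<le> \<delta>"
        "(\<Sum>j. hausdorff_weight s (C j)) < hausdorff_pre s \<delta> A + ennreal (e / 2)"
      using near[of A "e / 2"] fin e by auto
    obtain C' where C': "A' \<subseteq> (\<Union>j. C' j)" "\<forall>j. bounded (C' j) \<and> diameter (C' j) \<le> \<delta>"
        "(\<Sum>j. hausdorff_weight s (C' j)) < hausdorff_pre s \<delta> A' + ennreal (e / 2)"
      using near[of A' "e / 2"] fin e by auto
    have "hausdorff_pre s \<delta> (A \<union> A') \<le>
        (hausdorff_pre s \<delta> A + ennreal (e / 2)) + (hausdorff_pre s \<delta> A' + ennreal (e / 2))"
      using two[OF C(1,2) C'(1,2)] C(3) C'(3) by (meson add_mono less_imp_le order_trans)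
    also have "\<dots> = hausdorff_pre s \<delta> A + hausdorff_pre s \<delta> A' + (ennreal (e / 2) + ennreal (e / 2))"
      by (simp only: add_ac)
    also have "ennreal (e / 2) + ennreal (e / 2) = ennreal e"
      using e by (subst ennreal_plus[symmetric]) auto
    finally show "hausdorff_pre s \<delta> (A \<union> A') \<le> hausdorff_pre s \<delta> A + hausdorff_pre s \<delta> A' + ennreal e" .
  qed
qed

lemma hausdorff_measure_Un_le:
  "hausdorff_measure s (A \<union> A') \<le> hausdorff_measure s A + hausdorff_measure s A'"
proof (rule hausdorff_measure_least)
  fix \<delta> :: real assume "\<delta> > 0"
  then show "hausdorff_pre s \<delta> (A \<union> A') \<le> hausdorff_measure s A + hausdorff_measure s A'"
    by (intro order_trans[OF hausdorff_pre_Un_le] add_mono hausdorff_pre_le_measure)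
qed

lemma hausdorff_measure_finite_UN_le:
  assumes "finite I"
  shows "hausdorff_measure s (\<Union>i\<in>I. A i) \<le> (\<Sum>i\<in>I. hausdorff_measure s (A i))"
  using assms
proof (induction I rule: finite_induct)
  case empty
  have "hausdorff_measure s {} \<le> of_nat (card {}) * 0"
    by (intro hausdorff_measure_least hausdorff_pre_le_finite_cover[where D="\<lambda>_. {}"]) auto
  then show ?case by simp
next
  case (insert i I)
  then show ?case
    using hausdorff_measure_Un_le[of s "A i" "\<Union>i\<in>I. A i"] by (auto intro: order_trans add_left_mono)
qed

lemma separated_finite_family:
  fixes K :: "'i \<Rightarrow> 'a::{heine_borel} set"
  assumes I: "finite I" and K: "\<And>i. i \<in> I \<Longrightarrow> compact (K i)" "disjoint_family_on K I"
  shows "\<exists>\<delta>>0. \<forall>i\<in>I. \<forall>j\<in>I. i \<noteq> j \<longrightarrow> (\<forall>x\<in>K i. \<forall>y\<in>K j. \<delta> \<le> dist x y)"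
proof -
  have "\<exists>d>0. i \<noteq> j \<longrightarrow> (\<forall>x\<in>K i. \<forall>y\<in>K j. d \<le> dist x y)" if "i \<in> I" "j \<in> I" for i j
  proof (cases "i = j")
    case False
    then have "K i \<inter> K j = {}" using K(2) that by (auto simp: disjoint_family_on_def)
    from separate_compact_closed[OF K(1)[OF that(1)] compact_imp_closed[OF K(1)[OF that(2)]] this]
    show ?thesis by auto
  qed (auto intro: exI[of _ 1])
  then obtain d where d: "\<And>i j. i \<in> I \<Longrightarrow> j \<in> I \<Longrightarrow> d i j > 0 \<and> (i \<noteq> j \<longrightarrow> (\<forall>x\<in>K i. \<forall>y\<in>K j. d i j \<le> dist x y))"
    by metis
  define \<delta> where "\<delta> = Min (insert 1 ((\<lambda>(i, j). d i j) ` (I \<times> I)))"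
  have "\<delta> > 0" unfolding \<delta>_def using I d by (subst Min_gr_iff) auto
  moreover have "\<delta> \<le> d i j" if "i \<in> I" "j \<in> I" for i j
    unfolding \<delta>_def using I that by (intro Min_le) auto
  ultimately show ?thesis using d by (meson order_trans)
qed

text \<open>Disjoint compact sets have positive distance, so no set of small diameter meets two of them. A fine cover of the
union therefore splits into separate covers, and lower bounds for the single sets add up.\<close>
theorem hausdorff_measure_separated_ge:
  fixes K :: "'i \<Rightarrow> 'a::{heine_borel} set"
  assumes I: "finite I" and K: "\<And>i. i \<in> I \<Longrightarrow> compact (K i)" "disjoint_family_on K I"
    and v: "\<And>i C. i \<in> I \<Longrightarrow> K i \<subseteq> (\<Union>j. C j) \<Longrightarrow> \<forall>j. bounded (C j) \<Longrightarrow>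
              v \<le> (\<Sum>j::nat. hausdorff_weight s (C j))"
  shows "of_nat (card I) * v \<le> hausdorff_measure s (\<Union>i\<in>I. K i)"
proof -
  obtain \<delta> where \<delta>: "\<delta> > 0"
    and sep: "\<And>i j x y. i \<in> I \<Longrightarrow> j \<in> I \<Longrightarrow> i \<noteq> j \<Longrightarrow> x \<in> K i \<Longrightarrow> y \<in> K j \<Longrightarrow> \<delta> \<le> dist x y"
    using separated_finite_family[OF I K] by blast
  have "of_nat (card I) * v \<le> hausdorff_pre s (\<delta> / 2) (\<Union>i\<in>I. K i)"
  proof (rule hausdorff_pre_greatest)
    fix C :: "nat \<Rightarrow> 'a set"
    assume cov: "(\<Union>i\<in>I. K i) \<subseteq> (\<Union>j. C j)" and C: "\<forall>j. bounded (C j) \<and> diameter (C j) \<le> \<delta> / 2"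
    define D where "D i j = (if C j \<inter> K i = {} then {} else C j)" for i j
    have "of_nat (card I) * v = (\<Sum>i\<in>I. v)" by simp
    also have "\<dots> \<le> (\<Sum>i\<in>I. \<Sum>j. hausdorff_weight s (D i j))"
    proof (intro sum_mono v)
      fix i assume i: "i \<in> I"
      show "K i \<subseteq> (\<Union>j. D i j)"
      proof
        fix x assume x: "x \<in> K i"
        then obtain j where "x \<in> C j" using cov i by blast
        then show "x \<in> (\<Union>j. D i j)" using x by (intro UN_I[of j]) (auto simp: D_def)
      qed
      show "\<forall>j. bounded (D i j)" using C by (auto simp: D_def)
    qed
    also have "\<dots> = (\<Sum>j. \<Sum>i\<in>I. hausdorff_weight s (D i j))"
      by (rule suminf_sum[symmetric]) auto
    also have "\<dots> \<le> (\<Sum>j. hausdorff_weight s (C j))"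
    proof (rule suminf_le)
      fix j
      show "(\<Sum>i\<in>I. hausdorff_weight s (D i j)) \<le> hausdorff_weight s (C j)"
      proof (cases "\<exists>i\<in>I. C j \<inter> K i \<noteq> {}")
        case True
        then obtain i x where i: "i \<in> I" "x \<in> C j" "x \<in> K i" by blast
        have "D i' j = {}" if i': "i' \<in> I" "i' \<noteq> i" for i'
        proof (rule ccontr)
          assume "D i' j \<noteq> {}"
          then obtain y where y: "y \<in> C j" "y \<in> K i'" by (auto simp: D_def split: if_splits)
          have "dist x y \<le> \<delta> / 2"
            using diameter_bounded_bound[of "C j" x y] C i(2) y(1) by (meson order_trans)
          then show False using sep[OF i(1) i'(1) _ i(3) y(2)] i'(2) \<delta> by auto
        qed
        then have "(\<Sum>i\<in>I. hausdorff_weight s (D i j)) = (\<Sum>i\<in>{i}. hausdorff_weight s (D i j))"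
          using I i by (intro sum.mono_neutral_right) auto
        then show ?thesis by (simp add: D_def)
      next
        case False
        then show ?thesis by (simp add: D_def)
      qed
    qed auto
    finally show "of_nat (card I) * v \<le> (\<Sum>j. hausdorff_weight s (C j))" .
  qed
  also have "\<dots> \<le> hausdorff_measure s (\<Union>i\<in>I. K i)"
    using \<delta> by (intro hausdorff_pre_le_measure) auto
  finally show ?thesis .
qed

lemma hausdorff_weight_lipschitz_image:
  fixes C :: "'a::metric_space set" and \<Psi> :: "'a \<Rightarrow> 'b::real_normed_vector"
  assumes C: "bounded C" "D \<subseteq> C" and s: "s \<ge> 0"
    and lip: "\<And>x y. x \<in> D \<Longrightarrow> y \<in> D \<Longrightarrow> dist (\<Psi> x) (\<Psi> y) \<le> dist x y"
  shows "bounded (\<Psi> ` D)" and "hausdorff_weight s (\<Psi> ` D) \<le> hausdorff_weight s C"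
proof -
  have le: "dist (\<Psi> x) (\<Psi> y) \<le> diameter C" if "x \<in> D" "y \<in> D" for x y
    using lip[OF that] diameter_bounded_bound[OF C(1) subsetD[OF C(2) that(1)] subsetD[OF C(2) that(2)]] by linarith
  then show b: "bounded (\<Psi> ` D)" unfolding bounded_two_points by blast
  show "hausdorff_weight s (\<Psi> ` D) \<le> hausdorff_weight s C"
  proof (cases "D = {}")
    case False
    have "diameter (\<Psi> ` D) \<le> diameter C"
      using le False by (intro diameter_le) (auto simp: dist_norm)
    then have "(diameter (\<Psi> ` D) / 2) powr s \<le> (diameter C / 2) powr s"
      using s diameter_ge_0[OF b] by (intro powr_mono2) auto
    then show ?thesis
      using False C(2) s by (auto simp: hausdorff_weight_def intro!: ennreal_leI mult_left_mono)
  qed simp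
qed

text \<open>The set is divided according to the differences \<open>x\<^sub>j - x\<^sub>a\<close>, in steps of \<open>1 / N\<close>. Within one cell also
\<open>x\<^sub>a\<close> varies by less than \<open>1 / N\<close>, since otherwise one point would lie strictly above another in
every coordinate. So cells have diameter \<open>O(1 / N)\<close>. The slab leaves only \<open>O(N (t - s))\<close> values
for the difference with index \<open>b\<close>, hence \<open>O(N\<^sup>n\<^sup>-\<^sup>1 (t - s))\<close> cells.\<close>
lemma hausdorff_measure_antichain_slab_le:
  fixes E :: "(real ^ 'n) set"
  assumes ab: "a \<noteq> b" and E: "E \<subseteq> {0..1}" and st: "s < t"
    and anti: "\<And>x y. x \<in> E \<Longrightarrow> y \<in> E \<Longrightarrow> \<exists>j. y $ j \<le> x $ j"
  shows "hausdorff_measure (real CARD('n) - 1) (E \<inter> {x. s < x $ a - x $ b \<and> x $ a - x $ b \<le> t}) \<le>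
           ennreal (unit_ball_vol (real CARD('n) - 1) * (3 * real CARD('n)) ^ (CARD('n) - 1) * (t - s))"
proof (rule hausdorff_measure_least)
  let ?n = "real CARD('n)"
  let ?m = "CARD('n) - 1"
  fix \<delta> :: real assume \<delta>: "\<delta> > 0"
  have "card {a, b} \<le> CARD('n)" by (intro card_mono) auto
  then have n2: "2 \<le> CARD('n)" using ab by simp
  have m: "?n - 1 = real ?m" using n2 by (simp add: of_nat_diff)
  \<comment> \<open>\<open>N (t - s) \<ge> 1\<close> absorbs the rounding in the count of cells; the other bound makes cells smaller than \<open>\<delta>\<close>.\<close>
  obtain N0 :: nat where N0: "max (1 / (t - s)) (2 * ?n / \<delta>) < real N0" using reals_Archimedean2 by blast
  define N where "N = Suc N0"
  have N: "real N \<ge> 1" "1 \<le> real N * (t - s)" "?n * (2 / real N) \<le> \<delta>"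
    using N0 st \<delta> by (auto simp: N_def field_simps)
  define T :: "'n \<Rightarrow> int set" where
    "T j = (if j = a then {0} else if j = b then {\<lfloor>- real N * t\<rfloor>..\<lfloor>- real N * s\<rfloor>} else {-int N..int N})" for j
  define u where "u j = (if j = a then 1 else if j = b then 3 * real N * (t - s) else 3 * real N)" for j
  define P where "P = (\<Pi>\<^sub>E j\<in>UNIV. T j)"
  define D where "D z = {x \<in> E. \<forall>j. \<lfloor>real N * (x $ j - x $ a)\<rfloor> = z j}" for z
  have cov: "E \<inter> {x. s < x $ a - x $ b \<and> x $ a - x $ b \<le> t} \<subseteq> (\<Union>z\<in>P. D z)"
  proof
    fix x assume x: "x \<in> E \<inter> {x. s < x $ a - x $ b \<and> x $ a - x $ b \<le> t}"
    have x01: "0 \<le> x $ j" "x $ j \<le> 1" for j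
      using x E by (auto simp: less_eq_vec_def subset_iff)
    let ?z = "\<lambda>j. \<lfloor>real N * (x $ j - x $ a)\<rfloor>"
    have "?z j \<in> T j" for j
    proof -
      consider "j = a" | "j \<noteq> a" "j = b" | "j \<noteq> a" "j \<noteq> b" by blast
      then show ?thesis
      proof cases
        case 2
        have "real N * - t \<le> real N * (x $ b - x $ a)" "real N * (x $ b - x $ a) \<le> real N * - s"
          using x N(1) by (intro mult_left_mono; simp)+
        then show ?thesis using 2 ab by (auto simp: T_def intro!: floor_mono)
      next
        case 3
        have "real N * (-1) \<le> real N * (x $ j - x $ a)" "real N * (x $ j - x $ a) \<le> real N * 1"
          using x01[of j] x01[of a] N(1) by (intro mult_left_mono; simp)+
        then show ?thesis using 3 by (auto simp: T_def le_floor_iff floor_le_iff)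
      qed (simp add: T_def)
    qed
    then have "?z \<in> P" by (auto simp: P_def)
    then show "x \<in> (\<Union>z\<in>P. D z)" using x by (intro UN_I[of ?z]) (auto simp: D_def)
  qed
  have P: "finite P" unfolding P_def by (intro finite_PiE) (auto simp: T_def)
  have cell: "dist x y \<le> ?n * (2 / real N)" if x: "x \<in> D z" and y: "y \<in> D z" for x y z
  proof -
    have close: "\<bar>(x $ j - x $ a) - (y $ j - y $ a)\<bar> < 1 / real N" for j
    proof -
      have "\<lfloor>real N * (x $ j - x $ a)\<rfloor> = \<lfloor>real N * (y $ j - y $ a)\<rfloor>" using x y by (simp add: D_def)
      then have "\<bar>real N * (x $ j - x $ a) - real N * (y $ j - y $ a)\<bar> < 1" by linarith
      then have "real N * \<bar>(x $ j - x $ a) - (y $ j - y $ a)\<bar> < 1"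
        using N(1) by (simp add: right_diff_distrib[symmetric] abs_mult)
      then show ?thesis using N(1) by (simp add: field_simps)
    qed
    have xyE: "x \<in> E" "y \<in> E" using x y by (auto simp: D_def)
    obtain j where "y $ j \<le> x $ j" using anti[OF xyE] ..
    moreover obtain j' where "x $ j' \<le> y $ j'" using anti[OF xyE(2,1)] ..
    ultimately have "\<bar>x $ a - y $ a\<bar> < 1 / real N" using close[of j] close[of j'] by linarith
    then have "\<bar>x $ j - y $ j\<bar> \<le> 1 / real N + 1 / real N" for j using close[of j] by linarith
    then have "\<bar>x $ j - y $ j\<bar> \<le> 2 / real N" for j by (simp add: add_divide_distrib[symmetric])
    then have "(\<Sum>j\<in>UNIV. \<bar>(x - y) $ j\<bar>) \<le> (\<Sum>j\<in>(UNIV :: 'n set). 2 / real N)"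
      by (intro sum_mono) simp
    then show ?thesis using norm_le_l1_cart[of "x - y"] by (simp add: dist_norm)
  qed
  have bdd: "bounded (D z)" for z
    unfolding bounded_two_points using cell by blast
  have diam: "diameter (D z) \<le> ?n * (2 / real N)" for z
    using cell by (intro diameter_le) (auto simp: dist_norm)
  have w: "hausdorff_weight (?n - 1) (D z) \<le> ennreal (unit_ball_vol ?m * (?n / real N) ^ ?m)" for z
  proof (cases "D z = {}")
    case False
    have "(diameter (D z) / 2) powr real ?m \<le> (?n / real N) powr real ?m"
      using diam[of z] diameter_ge_0[OF bdd[of z]] by (intro powr_mono2) auto
    also have "\<dots> = (?n / real N) ^ ?m" using N(1) by (intro powr_realpow) auto
    finally show ?thesis
      unfolding hausdorff_weight_def m using False n2 by (auto intro!: ennreal_leI mult_left_mono)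
  qed simp
  have "real (card P) = (\<Prod>j\<in>UNIV. real (card (T j)))"
    unfolding P_def by (subst card_PiE) auto
  also have "\<dots> \<le> (\<Prod>j\<in>UNIV. u j)"
  proof (intro prod_mono conjI)
    fix j
    have "\<lfloor>- real N * s\<rfloor> - \<lfloor>- real N * t\<rfloor> + 1 \<le> 3 * real N * (t - s)"
    proof -
      have "\<lfloor>- real N * s\<rfloor> - \<lfloor>- real N * t\<rfloor> + 1 \<le> real N * (t - s) + 2"
        by (simp add: algebra_simps) linarith
      then show ?thesis using N(2) by simp
    qed
    moreover have "\<lfloor>- real N * t\<rfloor> \<le> \<lfloor>- real N * s\<rfloor>" using st by (intro floor_mono) (simp add: mult_left_mono)
    ultimately show "real (card (T j)) \<le> u j" using N(1) by (auto simp: T_def u_def)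
  qed auto
  also have "\<dots> = u a * (u b * (\<Prod>j\<in>UNIV - {a} - {b}. u j))"
    using ab by (subst prod.remove[of _ a], simp, simp, subst prod.remove[of _ b]) auto
  also have "(\<Prod>j\<in>UNIV - {a} - {b}. u j) = (\<Prod>j\<in>UNIV - {a} - {b}. 3 * real N)"
    by (intro prod.cong) (auto simp: u_def)
  also have "\<dots> = (3 * real N) ^ (CARD('n) - 2)"
    using ab by (simp add: card_Diff_singleton numeral_2_eq_2)
  also have "u a * (u b * (3 * real N) ^ (CARD('n) - 2)) = (t - s) * (3 * real N) ^ Suc (CARD('n) - 2)"
    using ab by (simp add: u_def)
  also have "Suc (CARD('n) - 2) = ?m" using n2 by simp
  finally have cardP: "real (card P) \<le> (t - s) * (3 * real N) ^ ?m" .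
  have "hausdorff_pre (?n - 1) \<delta> (E \<inter> {x. s < x $ a - x $ b \<and> x $ a - x $ b \<le> t}) \<le>
          of_nat (card P) * ennreal (unit_ball_vol ?m * (?n / real N) ^ ?m)"
    using \<delta> bdd order_trans[OF diam N(3)] w by (intro hausdorff_pre_le_finite_cover[OF P cov]) auto
  also have "\<dots> = ennreal (real (card P) * (unit_ball_vol ?m * (?n / real N) ^ ?m))"
    by (simp add: ennreal_of_nat_eq_real_of_nat ennreal_mult)
  also have "\<dots> \<le> ennreal ((t - s) * (3 * real N) ^ ?m * (unit_ball_vol ?m * (?n / real N) ^ ?m))"
    by (intro ennreal_leI mult_right_mono cardP) auto
  also have "(t - s) * (3 * real N) ^ ?m * (unit_ball_vol ?m * (?n / real N) ^ ?m) =
      unit_ball_vol ?m * ((3 * real N) * (?n / real N)) ^ ?m * (t - s)"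
    unfolding power_mult_distrib by simp
  also have "(3 * real N) * (?n / real N) = 3 * ?n" using N(1) by simp
  finally show "hausdorff_pre (?n - 1) \<delta> (E \<inter> {x. s < x $ a - x $ b \<and> x $ a - x $ b \<le> t}) \<le>
      ennreal (unit_ball_vol (?n - 1) * (3 * ?n) ^ ?m * (t - s))"
    unfolding m .
qed

section \<open>A Cantor function and its flat gaps\<close>

text \<open>For \<open>0 \<le> u < 1\<close> summation by parts shows that this is, up to the factor \<open>B / (B - 2)\<close>, the number
with the binary digits of \<open>u\<close> read in base \<open>B\<close>. Written with floors it is defined and visibly
increasing on the whole line.\<close>
definition digit_spread :: "real \<Rightarrow> real \<Rightarrow> real" where
  "digit_spread B u = (\<Sum>l. of_int \<lfloor>2 ^ l * u\<rfloor> / B ^ l)"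

lemma summable_digit_spread:
  fixes u :: real
  assumes B: "B > 2"
  shows "summable (\<lambda>l. of_int \<lfloor>2 ^ l * u\<rfloor> / B ^ l :: real)"
proof (rule summable_comparison_test')
  show "summable (\<lambda>l. \<bar>u\<bar> * (2 / B) ^ l + (1 / B) ^ l)"
    using B by (intro summable_add summable_mult) auto
  fix l :: nat
  have "\<bar>of_int \<lfloor>2 ^ l * u\<rfloor> :: real\<bar> \<le> \<bar>2 ^ l * u\<bar> + 1" by linarith
  then have "\<bar>of_int \<lfloor>2 ^ l * u\<rfloor> :: real\<bar> / B ^ l \<le> (2 ^ l * \<bar>u\<bar> + 1) / B ^ l"
    using B by (intro divide_right_mono) (auto simp: abs_mult)
  then show "norm (of_int \<lfloor>2 ^ l * u\<rfloor> / B ^ l :: real) \<le> \<bar>u\<bar> * (2 / B) ^ l + (1 / B) ^ l"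
    using B by (simp add: power_divide add_divide_distrib mult_ac)
qed

lemma digit_spread_strict_mono:
  assumes B: "B > 2"
  shows "strict_mono (digit_spread B)"
proof (rule strict_monoI)
  fix u v :: real assume uv: "u < v"
  obtain l where "1 / (v - u) < 2 ^ l" using real_arch_pow[of 2 "1 / (v - u)"] by auto
  then have "1 < 2 ^ l * v - 2 ^ l * u" using uv by (simp add: field_simps)
  then have l: "\<lfloor>2 ^ l * u\<rfloor> < \<lfloor>2 ^ l * v\<rfloor>" by linarith
  let ?D = "\<lambda>l. of_int \<lfloor>2 ^ l * v\<rfloor> / B ^ l - of_int \<lfloor>2 ^ l * u\<rfloor> / B ^ l :: real"
  have "0 < (\<Sum>l. ?D l)"
  proof (rule suminf_pos2[where i=l])
    show "summable ?D" by (intro summable_diff summable_digit_spread B)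
    show "0 \<le> ?D j" for j
      using B uv by (auto simp: diff_divide_distrib[symmetric] intro!: divide_nonneg_nonneg floor_mono)
    show "0 < ?D l" using l B by (auto simp: diff_divide_distrib[symmetric])
  qed
  also have "\<dots> = digit_spread B v - digit_spread B u"
    unfolding digit_spread_def by (intro suminf_diff[symmetric] summable_digit_spread B)
  finally show "digit_spread B u < digit_spread B v" by simp
qed

lemma digit_spread_add_int:
  assumes B: "B > 2"
  shows "digit_spread B (u + of_int m) = digit_spread B u + of_int m * (B / (B - 2))"
proof -
  have "norm (2 / B) < 1" using B by simp
  from geometric_sums[OF this]
  have g: "(\<lambda>l. of_int m * (2 / B) ^ l) sums (of_int m * (1 / (1 - 2 / B)))" by (rule sums_mult)
  have fl: "\<lfloor>2 ^ l * (u + of_int m)\<rfloor> = \<lfloor>2 ^ l * u\<rfloor> + 2 ^ l * m" for l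
  proof -
    have "2 ^ l * (u + of_int m) = 2 ^ l * u + of_int (2 ^ l * m)" by (simp add: algebra_simps)
    then show ?thesis by (simp only: floor_add_int)
  qed
  have "(\<lambda>l. of_int \<lfloor>2 ^ l * u\<rfloor> / B ^ l + of_int m * (2 / B) ^ l) sums
          (digit_spread B u + of_int m * (1 / (1 - 2 / B)))"
    unfolding digit_spread_def by (intro sums_add g summable_sums summable_digit_spread B)
  also have "(\<lambda>l. of_int \<lfloor>2 ^ l * u\<rfloor> / B ^ l + of_int m * (2 / B) ^ l) =
      (\<lambda>l. of_int \<lfloor>2 ^ l * (u + of_int m)\<rfloor> / B ^ l)"
    by (simp only: fl of_int_add of_int_mult of_int_power of_int_numeral)
       (simp add: add_divide_distrib power_divide mult_ac)
  finally have "digit_spread B (u + of_int m) = digit_spread B u + of_int m * (1 / (1 - 2 / B))"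
    unfolding digit_spread_def[of B "u + of_int m"] by (rule sums_unique[symmetric])
  also have "1 / (1 - 2 / B) = B / (B - 2)" using B by (simp add: field_simps)
  finally show ?thesis .
qed

lemma digit_spread_0 [simp]: "digit_spread B 0 = 0"
  by (simp add: digit_spread_def)

lemma digit_spread_int:
  "B > 2 \<Longrightarrow> digit_spread B (of_int m) = of_int m * (B / (B - 2))"
  using digit_spread_add_int[of B 0 m] by simp

lemma digit_spread_double:
  assumes B: "B > 2" and u: "0 \<le> u" "u < 1"
  shows "digit_spread B u = digit_spread B (2 * u) / B"
proof -
  have "digit_spread B u = of_int \<lfloor>2 ^ 0 * u\<rfloor> / B ^ 0 + (\<Sum>l. of_int \<lfloor>2 ^ Suc l * u\<rfloor> / B ^ Suc l)"
    unfolding digit_spread_def by (subst suminf_split_head[OF summable_digit_spread[OF B]]) simp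
  also have "\<lfloor>2 ^ 0 * u\<rfloor> = 0" using u by (simp add: floor_eq_iff)
  also have "(\<Sum>l. of_int \<lfloor>2 ^ Suc l * u\<rfloor> / B ^ Suc l) = (\<Sum>l. of_int \<lfloor>2 ^ l * (2 * u)\<rfloor> / B ^ l / B)"
    by (simp add: mult_ac)
  also have "\<dots> = digit_spread B (2 * u) / B"
    unfolding digit_spread_def by (rule suminf_divide[OF summable_digit_spread[OF B]])
  finally show ?thesis by simp
qed

definition cantor_set :: "real \<Rightarrow> real set" where
  "cantor_set B = closure (digit_spread B ` {0..<1})"

lemma compact_cantor_set:
  assumes B: "B > 2"
  shows "compact (cantor_set B)"
proof -
  have "digit_spread B ` {0..<1} \<subseteq> {digit_spread B 0..digit_spread B 1}"
    unfolding image_subset_iff atLeastAtMost_iff strict_mono_less_eq[OF digit_spread_strict_mono[OF B]] by auto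
  then have "bounded (digit_spread B ` {0..<1})" by (rule bounded_subset[OF bounded_closed_interval])
  then show ?thesis unfolding cantor_set_def by simp
qed

text \<open>\<open>d\<close> is the leading binary digit of the parameter, and \<open>z'\<close> belongs to the digits that remain.\<close>
lemma cantor_set_self_similar:
  assumes B: "B > 2" and z: "z \<in> cantor_set B"
  shows "\<exists>d\<in>{0, 1::nat}. \<exists>z'\<in>cantor_set B. z = (d * (B / (B - 2)) + z') / B"
proof -
  let ?\<kappa> = "B / (B - 2)"
  let ?h = "\<lambda>d::nat. \<lambda>z. (d * ?\<kappa> + z) / B"
  have "cantor_set B \<subseteq> ?h 0 ` cantor_set B \<union> ?h 1 ` cantor_set B"
    unfolding cantor_set_def
  proof (rule closure_minimal[of _ "?h 0 ` cantor_set B \<union> ?h 1 ` cantor_set B", unfolded cantor_set_def])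
    show "digit_spread B ` {0..<1} \<subseteq> ?h 0 ` closure (digit_spread B ` {0..<1}) \<union> ?h 1 ` closure (digit_spread B ` {0..<1})"
    proof (rule image_subsetI)
      fix u :: real assume u: "u \<in> {0..<1}"
      have half: "digit_spread B u = digit_spread B (2 * u) / B"
        using u by (intro digit_spread_double B) auto
      \<comment> \<open>The cases are the two possible leading binary digits of \<open>u\<close>.\<close>
      show "digit_spread B u \<in> ?h 0 ` closure (digit_spread B ` {0..<1}) \<union> ?h 1 ` closure (digit_spread B ` {0..<1})"
      proof (cases "u < 1 / 2")
        case True
        then have "digit_spread B (2 * u) \<in> closure (digit_spread B ` {0..<1})"
          using u by (intro closure_subset[THEN subsetD]) auto
        then show ?thesis using half by auto
      next
        case False
        then have "digit_spread B (2 * u - 1) \<in> closure (digit_spread B ` {0..<1})"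
          using u by (intro closure_subset[THEN subsetD] imageI) auto
        moreover have "digit_spread B u = ?h 1 (digit_spread B (2 * u - 1))"
          using half digit_spread_add_int[OF B, of "2 * u - 1" 1] by (simp add: add.commute)
        ultimately show ?thesis by blast
      qed
    qed
    show "closed (?h 0 ` closure (digit_spread B ` {0..<1}) \<union> ?h 1 ` closure (digit_spread B ` {0..<1}))"
      using compact_cantor_set[OF B, unfolded cantor_set_def] B
      by (intro closed_Un compact_imp_closed compact_continuous_image continuous_intros) auto
  qed
  then show ?thesis using z by blast
qed

text \<open>The generalized inverse of \<open>digit_spread\<close>, cut off below \<open>0\<close> and above \<open>1\<close>: for
\<open>B = 3\<close> this is the classical Cantor function up to scaling.\<close>
definition cantor_fun :: "real \<Rightarrow> real \<Rightarrow> real" where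
  "cantor_fun B y = max 0 (min 1 (Sup {u. digit_spread B u \<le> y}))"

context
  fixes B :: real
  assumes B: "B > 2"
begin

lemma digit_spread_le_iff: "digit_spread B u \<le> digit_spread B v \<longleftrightarrow> u \<le> v"
  by (rule strict_mono_less_eq[OF digit_spread_strict_mono[OF B]])

lemma digit_spread_sublevel:
  shows "bdd_above {u. digit_spread B u \<le> y}" and "{u. digit_spread B u \<le> y} \<noteq> {}"
proof -
  have k: "(B / (B - 2)) > 0" using B by simp
  have "y = (y / (B / (B - 2))) * (B / (B - 2))" using B by (simp add: field_simps)
  also have "\<dots> \<le> of_int \<lceil>y / (B / (B - 2))\<rceil> * (B / (B - 2))" using k by (intro mult_right_mono) auto
  also have "\<dots> = digit_spread B (of_int \<lceil>y / (B / (B - 2))\<rceil>)" using B by (simp add: digit_spread_int)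
  finally have "y \<le> digit_spread B (of_int \<lceil>y / (B / (B - 2))\<rceil>)" .
  then show "bdd_above {u. digit_spread B u \<le> y}"
    by (intro bdd_aboveI[of _ "of_int \<lceil>y / (B / (B - 2))\<rceil>"])
       (metis mem_Collect_eq digit_spread_le_iff order_trans)
  have "digit_spread B (of_int \<lfloor>y / (B / (B - 2))\<rfloor>) = of_int \<lfloor>y / (B / (B - 2))\<rfloor> * (B / (B - 2))" using B by (simp add: digit_spread_int)
  also have "\<dots> \<le> (y / (B / (B - 2))) * (B / (B - 2))" using k by (intro mult_right_mono) auto
  also have "\<dots> = y" using B by (simp add: field_simps)
  finally show "{u. digit_spread B u \<le> y} \<noteq> {}" by blast
qed

lemma Sup_sublevel_digit_spread: "Sup {v. digit_spread B v \<le> digit_spread B u} = u"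
  by (simp add: digit_spread_le_iff atMost_def[symmetric])

lemma Sup_sublevel_mono:
  "y \<le> y' \<Longrightarrow> Sup {v. digit_spread B v \<le> y} \<le> Sup {v. digit_spread B v \<le> y'}"
  by (intro cSup_subset_mono digit_spread_sublevel) auto

lemma cantor_fun_mono: "y \<le> y' \<Longrightarrow> cantor_fun B y \<le> cantor_fun B y'"
  using Sup_sublevel_mono[of y y'] by (auto simp: cantor_fun_def)

lemma cantor_fun_bounds: "0 \<le> cantor_fun B y" "cantor_fun B y \<le> 1"
  by (auto simp: cantor_fun_def)

lemma cantor_fun_eq_0: "y \<le> 0 \<Longrightarrow> cantor_fun B y = 0"
  using Sup_sublevel_mono[of y 0] Sup_sublevel_digit_spread[of 0] by (simp add: cantor_fun_def)

lemma cantor_fun_eq_1: "y \<ge> (B / (B - 2)) \<Longrightarrow> cantor_fun B y = 1"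
  using Sup_sublevel_mono[of "B / (B - 2)" y] Sup_sublevel_digit_spread[of 1] digit_spread_int[OF B, of 1]
  by (simp add: cantor_fun_def)

text \<open>An increasing function onto the line has no jumps.\<close>
lemma continuous_cantor_fun: "continuous_on UNIV (cantor_fun B)"
proof -
  have "range (\<lambda>y. Sup {u. digit_spread B u \<le> y}) = UNIV"
    by (rule surjI[where f="digit_spread B"]) (rule Sup_sublevel_digit_spread)
  then have "continuous_on UNIV (\<lambda>y. Sup {u. digit_spread B u \<le> y})"
    by (intro continuous_onI_mono Sup_sublevel_mono) auto
  then show ?thesis unfolding cantor_fun_def by (intro continuous_intros)
qed

text \<open>An increase between \<open>a\<close> and \<open>b\<close> would pass through two values \<open>u < v\<close>, and then
\<open>digit_spread B u\<close> would be a point of the Cantor set in the gap.\<close>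
lemma cantor_fun_locally_constant:
  assumes ab: "a \<le> b" and gap: "{a<..<b} \<inter> cantor_set B = {}"
  shows "cantor_fun B a = cantor_fun B b"
proof (rule ccontr)
  assume "cantor_fun B a \<noteq> cantor_fun B b"
  then have "cantor_fun B a < cantor_fun B b" using cantor_fun_mono[OF ab] by simp
  then obtain u v where uv: "cantor_fun B a < u" "u < v" "v < cantor_fun B b"
    using dense by metis
  then have uv01: "0 < u" "v < 1" using cantor_fun_bounds[of a] cantor_fun_bounds[of b] by linarith+
  have "Sup {w. digit_spread B w \<le> a} < u"
    using uv uv01 unfolding cantor_fun_def max_less_iff_conj min_less_iff_disj by linarith
  then have a: "a < digit_spread B u"
    using cSup_upper[OF _ digit_spread_sublevel(1), of u a] by (meson leD mem_Collect_eq not_le)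
  have "v < Sup {w. digit_spread B w \<le> b}"
    using uv uv01 unfolding cantor_fun_def less_max_iff_disj min_less_iff_conj by linarith
  then obtain w where "v < w" "digit_spread B w \<le> b"
    using less_cSup_iff[OF digit_spread_sublevel(2,1), of v b] by auto
  then have "digit_spread B u < b"
    using uv digit_spread_le_iff[of w u] by linarith
  moreover have "digit_spread B u \<in> cantor_set B"
    unfolding cantor_set_def using uv uv01 by (intro closure_subset[THEN subsetD] imageI) auto
  ultimately show False using a gap by auto
qed

lemma cantor_fun_pos:
  assumes y: "y > 0"
  shows "cantor_fun B y > 0"
proof -
  \<comment> \<open>\<open>digit_spread\<close> takes arbitrarily small positive values, at the powers of \<open>1/2\<close>.\<close>
  have val: "digit_spread B ((1/2) ^ m) = (B / (B - 2)) * (1 / B) ^ m" for m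
  proof (induction m)
    case 0
    show ?case using digit_spread_int[OF B, of 1] by (simp only: of_int_1 power_0 mult_1_left mult_1_right)
  next
    case (Suc m)
    have "digit_spread B ((1/2) ^ Suc m) = digit_spread B (2 * (1/2) ^ Suc m) / B"
      using power_Suc_less_one[of "1/2::real" m] by (intro digit_spread_double B) simp_all
    then show ?case using Suc by simp
  qed
  have "(\<lambda>m. (B / (B - 2)) * (1 / B) ^ m) \<longlonglongrightarrow> (B / (B - 2)) * 0"
    using B by (intro tendsto_intros LIMSEQ_power_zero) auto
  then have "\<forall>\<^sub>F m in sequentially. (B / (B - 2)) * (1 / B) ^ m < y" using y by (intro order_tendstoD) auto
  then obtain m where "(B / (B - 2)) * (1 / B) ^ m < y" by (auto simp: eventually_sequentially)
  then have "(1/2) ^ m \<le> Sup {u. digit_spread B u \<le> y}"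
    using val[of m] by (intro cSup_upper digit_spread_sublevel) auto
  moreover have "(0::real) < (1/2) ^ m" by simp
  ultimately have "0 < Sup {u. digit_spread B u \<le> y}" by linarith
  then show ?thesis by (auto simp: cantor_fun_def)
qed

end

section \<open>Mixing translates into a strictly increasing singular function\<close>

lemma compact_cube_vec:
  fixes Z :: "real set"
  assumes Z: "compact Z"
  shows "compact {z :: real ^ 'n. \<forall>j. z $ j \<in> Z}"
proof -
  obtain M where M: "\<And>z. z \<in> Z \<Longrightarrow> \<bar>z\<bar> \<le> M"
    using compact_imp_bounded[OF Z] by (auto simp: bounded_iff)
  have "norm z \<le> (\<Sum>j\<in>(UNIV :: 'n set). M)" if "\<forall>j. z $ j \<in> Z" for z :: "real ^ 'n"
  proof -
    have "(\<Sum>j\<in>UNIV. \<bar>z $ j\<bar>) \<le> (\<Sum>j\<in>(UNIV :: 'n set). M)"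
      using that M by (intro sum_mono) blast
    then show ?thesis using norm_le_l1_cart[of z] by linarith
  qed
  then have "bounded {z :: real ^ 'n. \<forall>j. z $ j \<in> Z}"
    by (intro boundedI) blast
  moreover have "closed (\<Inter>j. (\<lambda>z :: real ^ 'n. z $ j) -` Z)"
    using compact_imp_closed[OF Z] by (intro closed_INT ballI continuous_closed_vimage) auto
  moreover have "(\<Inter>j. (\<lambda>z :: real ^ 'n. z $ j) -` Z) = {z. \<forall>j. z $ j \<in> Z}" by auto
  ultimately show ?thesis by (simp add: compact_eq_bounded_closed)
qed

lemma emeasure_affine_image:
  fixes E :: "real set"
  assumes E: "compact E" and c: "c \<noteq> 0"
  shows "emeasure lborel ((\<lambda>x. t + c * x) ` E) = ennreal \<bar>c\<bar> * emeasure lborel E"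
proof -
  have inj: "inj (\<lambda>x. t + c * x)" using c by (intro injI) simp
  have "compact ((\<lambda>x. t + c * x) ` E)"
    by (intro compact_continuous_image E continuous_intros)
  then have F: "(\<lambda>x. t + c * x) ` E \<in> sets borel" and E': "E \<in> sets borel"
    using E by (auto intro: borel_compact)
  have "emeasure lborel ((\<lambda>x. t + c * x) ` E) = (\<integral>\<^sup>+x. indicator ((\<lambda>x. t + c * x) ` E) x \<partial>lborel)"
    using F by simp
  also have "\<dots> = ennreal \<bar>c\<bar> * (\<integral>\<^sup>+x. indicator ((\<lambda>x. t + c * x) ` E) (t + c * x) \<partial>lborel)"
    by (rule nn_integral_real_affine[OF borel_measurable_indicator[OF F] c])
  also have "(\<lambda>x. indicator ((\<lambda>x. t + c * x) ` E) (t + c * x)) = (indicator E :: real \<Rightarrow> ennreal)"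
    by (rule ext) (simp only: indicator_def inj_image_mem_iff[OF inj])
  also have "(\<integral>\<^sup>+x. indicator E x \<partial>lborel) = emeasure lborel E"
    using E' by simp
  finally show ?thesis .
qed

text \<open>The \<open>n\<close>-fold sumset \<open>Z + \<dots> + Z\<close>, with \<open>n\<close> summands indexed by the elements of a finite type;
the type argument only names that type.\<close>
definition sumset :: "'n itself \<Rightarrow> real set \<Rightarrow> real set" where
  "sumset _ Z = {\<Sum>j\<in>UNIV. z j | z :: 'n \<Rightarrow> real. \<forall>j. z j \<in> Z}"

text \<open>The sumset is self-similar: splitting off the leading digit of each summand, it is covered by \<open>n + 1\<close>
copies of itself (one for each sum of \<open>n\<close> digits from \<open>{0, 1}\<close>) scaled by
\<open>1 / B = 1 / (n + 2)\<close>. A finite measure \<open>e\<close> with \<open>e \<le> (n + 1) e / (n + 2)\<close> vanishes.\<close>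
lemma sumset_cantor_set_null:
  fixes N :: "'n :: finite itself"
  assumes B: "B = real CARD('n) + 2"
  shows "negligible (sumset N (cantor_set B))"
proof -
  define Z where "Z = cantor_set B"
  define E where "E = sumset N Z"
  have B2: "B > 2" using B by simp
  have Z: "compact Z" unfolding Z_def by (rule compact_cantor_set[OF B2])
  have "E = (\<lambda>z :: real ^ 'n. \<Sum>j\<in>UNIV. z $ j) ` {z. \<forall>j. z $ j \<in> Z}" (is "_ = ?R")
  proof
    show "E \<subseteq> ?R"
    proof
      fix x assume "x \<in> E"
      then obtain z :: "'n \<Rightarrow> real" where z: "\<forall>j. z j \<in> Z" "x = (\<Sum>j\<in>UNIV. z j)"
        by (auto simp: E_def sumset_def)
      then show "x \<in> ?R" by (intro image_eqI[of _ _ "\<chi> j. z j"]) auto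
    qed
  qed (auto simp: E_def sumset_def)
  also have "compact \<dots>"
    by (intro compact_continuous_image compact_cube_vec Z continuous_intros)
  finally have E: "compact E" .
  have "emeasure lborel E \<noteq> \<infinity>" using emeasure_compact_finite[OF E] by simp
  then obtain e where e: "emeasure lborel E = ennreal e" "e \<ge> 0" by (cases "emeasure lborel E") auto
  have "E \<subseteq> (\<Union>a\<le>CARD('n). (\<lambda>x. a * (1 / (B - 2)) + 1 / B * x) ` E)"
  proof
    fix x assume "x \<in> E"
    then obtain z :: "'n \<Rightarrow> real" where z: "\<forall>j. z j \<in> Z" "x = (\<Sum>j\<in>UNIV. z j)"
      by (auto simp: E_def sumset_def)
    from z(1) have "\<forall>j. \<exists>d\<in>{0, 1::nat}. \<exists>z'\<in>Z. z j = (d * (B / (B - 2)) + z') / B"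
      unfolding Z_def using cantor_set_self_similar[OF B2] by blast
    then obtain d :: "'n \<Rightarrow> nat" and z' where
      d: "\<And>j. d j \<in> {0, 1}" "\<And>j. z' j \<in> Z" "\<And>j. z j = (d j * (B / (B - 2)) + z' j) / B"
      by metis
    have "(\<Sum>j\<in>UNIV. z j) = (\<Sum>j\<in>UNIV. d j * (1 / (B - 2)) + 1 / B * z' j)"
      unfolding d(3) using B2 by (intro sum.cong refl) (simp add: field_simps)
    also have "\<dots> = (\<Sum>j\<in>UNIV. d j) * (1 / (B - 2)) + 1 / B * (\<Sum>j\<in>UNIV. z' j)"
      by (simp add: sum.distrib sum_distrib_left sum_distrib_right sum_divide_distrib)
    finally have "x = (\<lambda>x. real (\<Sum>j\<in>UNIV. d j) * (1 / (B - 2)) + 1 / B * x) (\<Sum>j\<in>UNIV. z' j)"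
      using z by simp
    moreover have "(\<Sum>j\<in>UNIV. z' j) \<in> E" using d by (auto simp: E_def sumset_def)
    moreover have "(\<Sum>j\<in>UNIV. d j) \<le> (\<Sum>j\<in>(UNIV :: 'n set). 1)"
      using d(1) by (intro sum_mono) (metis empty_iff insert_iff le_numeral_extra(4) zero_le_one)
    ultimately show "x \<in> (\<Union>a\<le>CARD('n). (\<lambda>x. a * (1 / (B - 2)) + 1 / B * x) ` E)"
      by (intro UN_I[of "\<Sum>j\<in>UNIV. d j"]) auto
  qed
  moreover have cpt: "compact ((\<lambda>x. t + 1 / B * x) ` E)" for t
    by (intro compact_continuous_image E continuous_intros)
  ultimately have "emeasure lborel E \<le> emeasure lborel (\<Union>a\<le>CARD('n). (\<lambda>x. a * (1 / (B - 2)) + 1 / B * x) ` E)"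
    by (intro emeasure_mono sets.finite_UN) (auto simp: borel_compact)
  also have "\<dots> \<le> (\<Sum>a\<le>CARD('n). emeasure lborel ((\<lambda>x. a * (1 / (B - 2)) + 1 / B * x) ` E))"
    using cpt by (intro emeasure_subadditive_finite) (auto simp: borel_compact)
  also have "\<dots> = (\<Sum>a\<le>CARD('n). ennreal (e / B))"
  proof (rule sum.cong[OF refl])
    fix a :: nat
    have "emeasure lborel ((\<lambda>x. a * (1 / (B - 2)) + 1 / B * x) ` E) = ennreal \<bar>1 / B\<bar> * emeasure lborel E"
      using B2 by (intro emeasure_affine_image E) auto
    also have "\<dots> = ennreal (e / B)"
      unfolding e(1) using B2 e(2) by (subst ennreal_mult[symmetric]) auto
    finally show "emeasure lborel ((\<lambda>x. a * (1 / (B - 2)) + 1 / B * x) ` E) = ennreal (e / B)" .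
  qed
  also have "\<dots> = ennreal (\<Sum>a\<le>CARD('n). e / B)"
    using B2 e(2) by (intro sum_ennreal) auto
  finally have "e \<le> (\<Sum>a\<le>CARD('n). e / B)"
    unfolding e(1) by (subst (asm) ennreal_le_iff) (use B2 e(2) in \<open>auto intro!: sum_nonneg\<close>)
  then have "e \<le> real (CARD('n) + 1) * (e / B)" by simp
  then have "e * B \<le> real (CARD('n) + 1) * e" using B2 by (simp add: field_simps)
  then have "e * (B - real (CARD('n) + 1)) \<le> 0" by (simp add: algebra_simps)
  then have "e \<le> 0" using B by simp
  then have "E \<in> null_sets lborel" using e E by (auto simp: null_sets_def borel_compact)
  then have "negligible E" by (simp add: negligible_iff_null_sets null_sets_completionI)
  then show ?thesis by (simp add: E_def Z_def)
qed

definition offset :: "nat \<Rightarrow> real" where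
  "offset q = of_rat (nat_to_rat_surj q)"

lemma offset_rational: "offset q \<in> \<rat>" by (simp add: offset_def)

lemma offset_between: "x < y \<Longrightarrow> \<exists>q. x < offset q \<and> offset q < y"
proof -
  assume "x < y"
  then obtain r where "x < of_rat r" "of_rat r < y" using of_rat_dense by blast
  moreover obtain q where "nat_to_rat_surj q = r" using surj_nat_to_rat_surj by (metis surjD)
  ultimately show ?thesis by (auto simp: offset_def)
qed

definition partial_mix :: "real \<Rightarrow> nat \<Rightarrow> real \<Rightarrow> real" where
  "partial_mix B p y = (\<Sum>q<p. (1/2) ^ Suc q * cantor_fun B (y - offset q))"

text \<open>A single Cantor function is constant on gaps; a weighted sum of its translates by all rationals is still singular
but strictly increasing. The weights sum to \<open>1\<close>.\<close>
definition mix :: "real \<Rightarrow> real \<Rightarrow> real" where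
  "mix B y = (\<Sum>q. (1/2) ^ Suc q * cantor_fun B (y - offset q))"

text \<open>All the growth of \<open>partial_mix B p\<close> happens on this compact set.\<close>
definition carrier_set :: "real \<Rightarrow> nat \<Rightarrow> real set" where
  "carrier_set B p = (\<Union>q<p. (\<lambda>z. offset q + z) ` cantor_set B)"

lemma negligible_sumset_carrier_set:
  fixes N :: "'n :: finite itself"
  assumes B: "B = real CARD('n) + 2"
  shows "negligible (\<Union>p. sumset N (carrier_set B p))"
proof (rule negligible_subset)
  show "negligible (\<Union>s\<in>\<rat>. (+) s ` sumset N (cantor_set B))"
  proof (rule negligible_countable_Union)
    show "countable ((\<lambda>s. (+) s ` sumset N (cantor_set B)) ` \<rat>)"
      by (intro countable_image countable_rat)
    fix S assume "S \<in> (\<lambda>s. (+) s ` sumset N (cantor_set B)) ` \<rat>"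
    then obtain s where "S = (+) s ` sumset N (cantor_set B)" by blast
    then show "negligible S"
      by (simp only: negligible_translation[OF sumset_cantor_set_null[OF B]])
  qed
  show "(\<Union>p. sumset N (carrier_set B p)) \<subseteq> (\<Union>s\<in>\<rat>. (+) s ` sumset N (cantor_set B))"
  proof
    fix x assume "x \<in> (\<Union>p. sumset N (carrier_set B p))"
    then obtain p and y :: "'n \<Rightarrow> real" where y: "\<forall>j. y j \<in> carrier_set B p" "x = (\<Sum>j\<in>UNIV. y j)"
      by (auto simp: sumset_def)
    have "\<forall>j. \<exists>w. snd w \<in> cantor_set B \<and> y j = offset (fst w) + snd w"
    proof
      fix j
      obtain q z where "z \<in> cantor_set B" "y j = offset q + z"
        using spec[OF y(1), of j] by (auto simp: carrier_set_def)
      then show "\<exists>w. snd w \<in> cantor_set B \<and> y j = offset (fst w) + snd w"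
        by (intro exI[of _ "(q, z)"]) simp
    qed
    from choice[OF this] obtain w where
      w: "\<forall>j. snd (w j) \<in> cantor_set B \<and> y j = offset (fst (w j)) + snd (w j)" by blast
    have "x = (\<Sum>j\<in>UNIV. offset (fst (w j)) + snd (w j))"
      unfolding y(2) using w by (intro sum.cong) auto
    also have "\<dots> = (\<Sum>j\<in>UNIV. offset (fst (w j))) + (\<Sum>j\<in>UNIV. snd (w j))" by (rule sum.distrib)
    finally have x: "x = (\<Sum>j\<in>UNIV. offset (fst (w j))) + (\<Sum>j\<in>UNIV. snd (w j))" .
    have "(\<Sum>j\<in>UNIV. snd (w j)) \<in> sumset N (cantor_set B)"
      unfolding sumset_def using w by (intro CollectI exI[of _ "\<lambda>j. snd (w j)"]) simp
    then have "x \<in> (+) (\<Sum>j\<in>UNIV. offset (fst (w j))) ` sumset N (cantor_set B)"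
      unfolding x by (rule imageI)
    then show "x \<in> (\<Union>s\<in>\<rat>. (+) s ` sumset N (cantor_set B))"
      by (rule UN_I[rotated]) (intro Rats_sum offset_rational)
  qed
qed

lemma compact_carrier_set: "B > 2 \<Longrightarrow> compact (carrier_set B p)"
  unfolding carrier_set_def
  by (intro compact_UN compact_continuous_image compact_cantor_set continuous_intros) auto

context
  fixes B :: real
  assumes B: "B > 2"
begin

lemma mix_term_bounds:
  "0 \<le> (1/2) ^ Suc q * cantor_fun B y" "(1/2) ^ Suc q * cantor_fun B y \<le> (1/2::real) ^ Suc q"
  using cantor_fun_bounds[OF B, of y] by (auto intro!: mult_left_le simp del: power_Suc)

lemma norm_mix_term: "norm ((1/2) ^ Suc q * cantor_fun B y) \<le> (1/2) ^ Suc q"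
  using mix_term_bounds[of q y] by (simp only: real_norm_def abs_of_nonneg)

lemma summable_mix: "summable (\<lambda>q. (1/2) ^ Suc q * cantor_fun B (y - offset q))"
  by (rule summable_comparison_test'[OF sums_summable[OF power_half_series] norm_mix_term])

lemma mix_bounds: "0 \<le> mix B y" "mix B y \<le> 1"
proof -
  show "0 \<le> mix B y" unfolding mix_def by (intro suminf_nonneg summable_mix mix_term_bounds)
  have "mix B y \<le> (\<Sum>q. (1/2) ^ Suc q)"
    unfolding mix_def by (intro suminf_le mix_term_bounds summable_mix sums_summable[OF power_half_series])
  then show "mix B y \<le> 1" using sums_unique[OF power_half_series] by simp
qed

lemma continuous_partial_mix: "continuous_on UNIV (partial_mix B p)"
proof -
  have "continuous_on UNIV (\<lambda>y. cantor_fun B (y - c))" for c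
    by (rule continuous_on_compose2[OF continuous_cantor_fun[OF B]]) (intro continuous_intros, simp)
  then have "continuous_on UNIV (\<lambda>y. (1/2) ^ Suc q * cantor_fun B (y - offset q))" for q
    by (intro continuous_on_mult continuous_on_const)
  then show ?thesis unfolding partial_mix_def by (intro continuous_on_sum)
qed

lemma continuous_mix: "continuous_on UNIV (mix B)"
proof (rule uniform_limit_theorem)
  show "\<forall>\<^sub>F p in sequentially. continuous_on UNIV (partial_mix B p)"
    by (intro always_eventually allI continuous_partial_mix)
  show "uniform_limit UNIV (partial_mix B) (mix B) sequentially"
    unfolding partial_mix_def[abs_def] mix_def[abs_def]
    by (rule Weierstrass_m_test[OF norm_mix_term sums_summable[OF power_half_series]])
qed simp

text \<open>The remaining terms of the series increase as well. Hence \<open>partial_mix B p\<close> is a 1-Lipschitz function of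
\<open>mix B\<close>.\<close>
lemma partial_mix_increment:
  assumes "y \<le> y'"
  shows "0 \<le> partial_mix B p y' - partial_mix B p y"
    and "partial_mix B p y' - partial_mix B p y \<le> mix B y' - mix B y"
proof -
  let ?D = "\<lambda>q. (1/2) ^ Suc q * cantor_fun B (y' - offset q) - (1/2) ^ Suc q * cantor_fun B (y - offset q)"
  have D: "0 \<le> ?D q" for q
    unfolding diff_ge_0_iff_ge using assms by (intro mult_left_mono cantor_fun_mono[OF B]) auto
  have eq: "partial_mix B p y' - partial_mix B p y = sum ?D {..<p}"
    by (simp only: partial_mix_def sum_subtractf)
  show "0 \<le> partial_mix B p y' - partial_mix B p y" unfolding eq by (intro sum_nonneg D)
  have "sum ?D {..<p} \<le> suminf ?D" by (intro sum_le_suminf summable_diff summable_mix finite_lessThan D)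
  also have "\<dots> = mix B y' - mix B y" unfolding mix_def by (intro suminf_diff[symmetric] summable_mix)
  finally show "partial_mix B p y' - partial_mix B p y \<le> mix B y' - mix B y" unfolding eq .
qed

text \<open>If a rational lies strictly between two points, the Cantor function translated by that rational is zero at the
left one and positive at the right one.\<close>
lemma strict_mono_mix: "strict_mono (mix B)"
proof (rule strict_monoI)
  fix y y' :: real assume "y < y'"
  then obtain q where q: "y < offset q" "offset q < y'" using offset_between by blast
  have "cantor_fun B (y - offset q) = 0" using q by (intro cantor_fun_eq_0[OF B]) auto
  moreover have "0 < cantor_fun B (y' - offset q)" using q by (intro cantor_fun_pos B) auto
  ultimately have "0 < (1/2) ^ Suc q * cantor_fun B (y' - offset q) - (1/2) ^ Suc q * cantor_fun B (y - offset q)"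
    by simp
  also have "\<dots> = (partial_mix B (Suc q) y' - partial_mix B (Suc q) y) - (partial_mix B q y' - partial_mix B q y)"
    by (simp add: partial_mix_def)
  also have "\<dots> \<le> partial_mix B (Suc q) y' - partial_mix B (Suc q) y"
    using partial_mix_increment(1)[of y y' q] \<open>y < y'\<close> by simp
  also have "\<dots> \<le> mix B y' - mix B y" using \<open>y < y'\<close> by (intro partial_mix_increment) auto
  finally show "mix B y < mix B y'" by simp
qed

lemma partial_mix_locally_constant:
  assumes ab: "a \<le> b" and gap: "{a<..<b} \<inter> carrier_set B p = {}"
  shows "partial_mix B p a = partial_mix B p b"
  unfolding partial_mix_def
proof (intro sum.cong refl arg_cong2[where f="(*)"])
  fix q assume q: "q \<in> {..<p}"
  have "offset q + z \<notin> {a<..<b}" if "z \<in> cantor_set B" for z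
  proof -
    have "offset q + z \<in> carrier_set B p" using q that unfolding carrier_set_def by blast
    then show ?thesis using gap by blast
  qed
  then show "cantor_fun B (a - offset q) = cantor_fun B (b - offset q)"
    using ab by (intro cantor_fun_locally_constant[OF B]) (auto simp: algebra_simps)
qed

text \<open>Every value in the range of \<open>partial_mix B p\<close> is attained on \<open>carrier_set B p\<close>: a point outside can be
moved to a nearest point of the set, as the function is constant in between.\<close>
lemma partial_mix_onto:
  assumes p: "p > 0" and v: "0 \<le> v" "v \<le> 1 - (1/2) ^ p"
  shows "\<exists>z\<in>carrier_set B p. partial_mix B p z = v"
proof -
  let ?\<kappa> = "B / (B - 2)"
  \<comment> \<open>Outside \<open>[-R, B / (B - 2) + R]\<close> all the translates involved are \<open>0\<close> or all are \<open>1\<close>.\<close>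
  define R where "R = (\<Sum>q<p. \<bar>offset q\<bar>)"
  have R: "\<bar>offset q\<bar> \<le> R" if "q < p" for q
    unfolding R_def using that by (intro member_le_sum) auto
  have lo: "partial_mix B p (- R) = 0"
    unfolding partial_mix_def
  proof (intro sum.neutral ballI)
    fix q assume "q \<in> {..<p}"
    then have "- R - offset q \<le> 0" using R[of q] by auto
    then show "(1/2) ^ Suc q * cantor_fun B (- R - offset q) = 0"
      by (simp add: cantor_fun_eq_0[OF B])
  qed
  have "partial_mix B p (?\<kappa> + R) = (\<Sum>q<p. (1/2) ^ Suc q)"
    unfolding partial_mix_def
  proof (intro sum.cong refl)
    fix q assume "q \<in> {..<p}"
    then have "?\<kappa> \<le> ?\<kappa> + R - offset q" using R[of q] by auto
    then show "(1/2) ^ Suc q * cantor_fun B (?\<kappa> + R - offset q) = (1/2) ^ Suc q"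
      by (simp add: cantor_fun_eq_1[OF B])
  qed
  also have "\<dots> = 1 - (1/2) ^ p" by (induction p) auto
  finally have hi: "partial_mix B p (?\<kappa> + R) = 1 - (1/2) ^ p" .
  have "R \<ge> 0" unfolding R_def by (intro sum_nonneg) auto
  moreover have "?\<kappa> > 0" using B by simp
  ultimately have "- R \<le> ?\<kappa> + R" by linarith
  then obtain y where y: "partial_mix B p y = v"
    using IVT'[of "partial_mix B p" "-R" v "?\<kappa> + R"] v lo hi
      continuous_on_subset[OF continuous_partial_mix] by auto
  have "cantor_set B \<noteq> {}" by (auto simp: cantor_set_def)
  then have "carrier_set B p \<noteq> {}" using p by (auto simp: carrier_set_def)
  then obtain z where z: "z \<in> carrier_set B p" "\<And>w. w \<in> carrier_set B p \<Longrightarrow> dist y z \<le> dist y w"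
    using distance_attains_inf[OF compact_imp_closed[OF compact_carrier_set[OF B]]] by metis
  have gap: "{min y z<..<max y z} \<inter> carrier_set B p = {}"
  proof -
    have "dist y w < dist y z" if "min y z < w" "w < max y z" for w
      using that by (auto simp: dist_real_def min_def max_def split: if_splits)
    then show ?thesis using z(2) by force
  qed
  have "partial_mix B p (min y z) = partial_mix B p (max y z)"
    by (rule partial_mix_locally_constant[OF _ gap]) auto
  then have "partial_mix B p z = v" using y by (auto simp: min_def max_def split: if_splits)
  then show ?thesis using z(1) by blast
qed

end

section \<open>Antichains from level sets\<close>

definition level_set :: "real \<Rightarrow> real \<Rightarrow> (real ^ 'n) set" where
  "level_set B c = {\<chi> j. mix B (y j) | y. (\<Sum>j\<in>UNIV. y j) = c}"

text \<open>The part of the level set that faces direction \<open>i\<close>: the other coordinates are in the image of the thin set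
\<open>carrier_set B p\<close>.\<close>
definition piece :: "real \<Rightarrow> nat \<Rightarrow> 'n \<Rightarrow> real \<Rightarrow> (real ^ 'n) set" where
  "piece B p i c = {\<chi> j. mix B (y j) | y. (\<Sum>j\<in>UNIV. y j) = c \<and> (\<forall>j. j \<noteq> i \<longrightarrow> y j \<in> carrier_set B p)}"

lemma piece_subset_level_set: "piece B p i c \<subseteq> level_set B c"
  by (auto simp: piece_def level_set_def)

lemma mix_le_iff: "B > 2 \<Longrightarrow> mix B y \<le> mix B y' \<longleftrightarrow> y \<le> y'"
  by (rule strict_mono_less_eq[OF strict_mono_mix])

lemma mix_eq_iff: "B > 2 \<Longrightarrow> mix B y = mix B y' \<longleftrightarrow> y = y'"
  by (rule strict_mono_eq[OF strict_mono_mix])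

lemma level_set_subset_cube: "B > 2 \<Longrightarrow> level_set B c \<subseteq> {0..1 :: real ^ 'n}"
  by (auto simp: level_set_def less_eq_vec_def mix_bounds)

text \<open>Comparable points have comparable parameter vectors, and these have the same sum.\<close>
lemma level_set_antichain:
  fixes x x' :: "real ^ 'n"
  assumes B: "B > 2" and x: "x \<in> level_set B c" "x' \<in> level_set B c" and le: "x \<le> x'"
  shows "x = x'"
proof -
  obtain y y' where y: "x = (\<chi> j. mix B (y j))" "(\<Sum>j\<in>UNIV. y j) = c"
    and y': "x' = (\<chi> j. mix B (y' j))" "(\<Sum>j\<in>UNIV. y' j) = c"
    using x by (auto simp: level_set_def)
  have le: "y j \<le> y' j" for j using le by (simp add: y y' less_eq_vec_def mix_le_iff[OF B])
  have "(\<Sum>j\<in>UNIV. y' j - y j) = 0" using y y' by (simp add: sum_subtractf)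
  then have "\<forall>j\<in>UNIV. y' j - y j = 0" by (subst (asm) sum_nonneg_eq_0_iff) (auto simp: le)
  then show ?thesis by (simp add: y y')
qed

lemma level_set_not_strictly_below:
  fixes x x' :: "real ^ 'n"
  assumes B: "B > 2" and x: "x \<in> level_set B c" "x' \<in> level_set B c"
  shows "\<exists>j. x' $ j \<le> x $ j"
proof (rule ccontr)
  assume "\<not> ?thesis"
  then have lt: "x $ j < x' $ j" for j by (simp add: not_le)
  then have "x \<le> x'" by (auto simp: less_eq_vec_def intro: less_imp_le)
  from level_set_antichain[OF B x this] lt show False by simp
qed

text \<open>A chain meets each level set in at most one point.\<close>
lemma k_antichain_Union_level_sets:
  fixes A :: "(real ^ 'n) set"
  assumes B: "B > 2" and cs: "finite cs" "card cs = k" and A: "A \<subseteq> (\<Union>c\<in>cs. level_set B c)"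
  shows "k_antichain k {0..1} A"
  unfolding k_antichain_def
proof (intro conjI allI impI)
  show "A \<subseteq> {0..1}" using A level_set_subset_cube[OF B] by blast
  fix C :: "(real ^ 'n) set" assume C: "C \<subseteq> {0..1} \<and> Complete_Partial_Order.chain (\<le>) C"
  have one: "\<exists>z. level_set B c \<inter> C \<subseteq> {z}" for c
  proof (cases "level_set B c \<inter> C = {}")
    case False
    then obtain z where z: "z \<in> level_set B c" "z \<in> C" by blast
    have "x = z" if x: "x \<in> level_set B c" "x \<in> C" for x
      using C chainD[of "(\<le>)" C x z] x z level_set_antichain[OF B x(1) z(1)] level_set_antichain[OF B z(1) x(1)]
      by blast
    then show ?thesis by blast
  qed auto
  have cover: "A \<inter> C \<subseteq> (\<Union>c\<in>cs. level_set B c \<inter> C)" using A by blast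
  have fin: "finite (level_set B c \<inter> C)" for c using one[of c] by (auto intro: finite_subset)
  have card1: "card (level_set B c \<inter> C) \<le> 1" for c
  proof -
    obtain z where "level_set B c \<inter> C \<subseteq> {z}" using one by blast
    then show ?thesis using card_mono[of "{z}" "level_set B c \<inter> C"] by simp
  qed
  show "finite (A \<inter> C)" using finite_subset[OF cover] fin cs by blast
  have "card (A \<inter> C) \<le> card (\<Union>c\<in>cs. level_set B c \<inter> C)" using fin cs by (intro card_mono cover) blast
  also have "\<dots> \<le> (\<Sum>c\<in>cs. card (level_set B c \<inter> C))" by (rule card_UN_le[OF cs(1)])
  also have "\<dots> \<le> (\<Sum>c\<in>cs. 1)" by (intro sum_mono card1)
  finally show "card (A \<inter> C) \<le> k" using cs by simp
qed

text \<open>The \<open>i\<close>-th of the parameters is determined by the others, which range over a compact set; so the piece is a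
continuous image of a compact cube, whose \<open>i\<close>-th coordinate is a dummy.\<close>
lemma compact_piece:
  assumes B: "B > 2" and p: "p > 0"
  shows "compact (piece B p i c :: (real ^ 'n) set)"
proof -
  define h :: "real ^ 'n \<Rightarrow> real ^ 'n" where
    "h z = (\<chi> j. mix B (if j = i then c - (\<Sum>l\<in>-{i}. z $ l) else z $ j))" for z
  have "carrier_set B p \<noteq> {}" using partial_mix_onto[OF B p, of 0] by (auto simp: power_le_one)
  then obtain z0 where z0: "z0 \<in> carrier_set B p" by blast
  have split: "(\<Sum>j\<in>UNIV. g j) = g i + (\<Sum>j\<in>-{i}. g j)" for g :: "'n \<Rightarrow> real"
    by (subst sum.remove[of _ i]) (auto simp: Compl_eq_Diff_UNIV)
  have "piece B p i c = h ` {z. \<forall>j. z $ j \<in> carrier_set B p}" (is "_ = h ` ?Z")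
  proof
    show "piece B p i c \<subseteq> h ` ?Z"
    proof
      fix x assume "x \<in> piece B p i c"
      then obtain y where y: "x = (\<chi> j. mix B (y j))" "(\<Sum>j\<in>UNIV. y j) = c"
          "\<And>j. j \<noteq> i \<Longrightarrow> y j \<in> carrier_set B p"
        by (auto simp: piece_def)
      let ?z = "\<chi> j. if j = i then z0 else y j"
      have "(\<Sum>l\<in>-{i}. ?z $ l) = (\<Sum>l\<in>-{i}. y l)" by (intro sum.cong) auto
      then have "y i = c - (\<Sum>l\<in>-{i}. ?z $ l)" using y(2) split[of y] by simp
      then have "x = h ?z" by (auto simp: y(1) h_def vec_eq_iff)
      moreover have "?z \<in> ?Z" using y z0 by auto
      ultimately show "x \<in> h ` ?Z" by (rule image_eqI)
    qed
    show "h ` ?Z \<subseteq> piece B p i c"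
    proof (rule image_subsetI)
      fix z assume z: "z \<in> ?Z"
      let ?y = "\<lambda>j. if j = i then c - (\<Sum>l\<in>-{i}. z $ l) else z $ j"
      have "(\<Sum>j\<in>-{i}. ?y j) = (\<Sum>l\<in>-{i}. z $ l)" by (intro sum.cong) auto
      then have "(\<Sum>j\<in>UNIV. ?y j) = c" unfolding split[of ?y] by simp
      then show "h z \<in> piece B p i c" unfolding piece_def h_def using z
        by (intro CollectI exI[of _ ?y]) auto
    qed
  qed
  also have "compact \<dots>"
  proof (rule compact_continuous_image[OF _ compact_cube_vec[OF compact_carrier_set[OF B]]])
    have "continuous_on UNIV (\<lambda>z :: real ^ 'n. if j = i then c - (\<Sum>l\<in>-{i}. z $ l) else z $ j)" for j
      by (cases "j = i") (auto intro!: continuous_intros)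
    from continuous_on_compose2[OF continuous_mix[OF B] this]
    have "continuous_on UNIV h" unfolding h_def by (intro continuous_on_vec_lambda) auto
    then show "continuous_on {z. \<forall>j. z $ j \<in> carrier_set B p} h" by (rule continuous_on_subset) auto
  qed
  finally show ?thesis .
qed

text \<open>A common point has a unique parameter vector. If it faced two directions, all parameters would be in
\<open>carrier_set B p\<close>, and \<open>c\<close> would be a sum of such elements.\<close>
lemma pieces_disjoint:
  fixes N :: "'n :: finite itself"
  assumes B: "B > 2" and ci: "(c, i) \<noteq> (c', i')" and c: "c \<notin> sumset N (carrier_set B p)"
  shows "piece B p i c \<inter> piece B p i' c' = ({} :: (real ^ 'n) set)"
proof (rule ccontr)
  assume "\<not> ?thesis"
  then obtain x :: "real ^ 'n" where x: "x \<in> piece B p i c" "x \<in> piece B p i' c'" by blast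
  obtain y where y: "x = (\<chi> j. mix B (y j))" "(\<Sum>j\<in>UNIV. y j) = c" "\<And>j. j \<noteq> i \<Longrightarrow> y j \<in> carrier_set B p"
    using x(1) by (auto simp: piece_def)
  obtain y' where y': "x = (\<chi> j. mix B (y' j))" "(\<Sum>j\<in>UNIV. y' j) = c'" "\<And>j. j \<noteq> i' \<Longrightarrow> y' j \<in> carrier_set B p"
    using x(2) by (auto simp: piece_def)
  have "y = y'" using y(1) y'(1) by (auto simp: vec_eq_iff mix_eq_iff[OF B])
  then have "c = c'" using y y' by simp
  then have "i \<noteq> i'" using ci by auto
  then have "y j \<in> carrier_set B p" for j using y(3) y'(3) \<open>y = y'\<close> by (cases "j = i") auto
  then have "c \<in> sumset N (carrier_set B p)" using y(2) by (auto simp: sumset_def)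
  then show False using c by simp
qed

text \<open>In the coordinates other than \<open>i\<close>, replace \<open>mix B y\<close> by \<open>partial_mix B p y\<close>. This does not
increase distances and maps the piece onto the full cube of side \<open>1 - 2\<^sup>-\<^sup>p\<close> in the hyperplane
\<open>x\<^sub>i = 0\<close>. The images of the covering sets cover that cube, and by the isodiametric inequality the measure of
each of them is at most the weight of the covering set.\<close>
lemma piece_cover_ge:
  fixes C :: "nat \<Rightarrow> (real ^ 'n) set"
  assumes B: "B > 2" and p: "p > 0"
    and cov: "piece B p i c \<subseteq> (\<Union>j. C j)" and bdd: "\<forall>j. bounded (C j)"
  shows "ennreal ((1 - (1/2) ^ p) ^ (CARD('n) - 1)) \<le> (\<Sum>j. hausdorff_weight (real CARD('n) - 1) (C j))"
proof -
  let ?M = "\<Pi>\<^sub>M j\<in>-{i}. (lborel :: real measure)"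
  interpret product_sigma_finite "\<lambda>_::'n. lborel :: real measure" by standard
  define v :: real where "v = 1 - (1/2) ^ p"
  have v: "v \<ge> 0" by (simp add: v_def power_le_one)
  \<comment> \<open>\<open>S\<close> is \<open>partial_mix B p\<close> as a function of the value of \<open>mix B\<close>.\<close>
  define S where "S x = partial_mix B p (inv (mix B) x)" for x
  have S: "S (mix B y) = partial_mix B p y" for y
    unfolding S_def by (simp add: inv_f_f[OF strict_mono_imp_inj_on[OF strict_mono_mix[OF B]]])
  define \<Psi> :: "real ^ 'n \<Rightarrow> real ^ 'n" where "\<Psi> x = (\<chi> j. if j = i then 0 else S (x $ j))" for x
  define X where "X j = \<Psi> ` (C j \<inter> piece B p i c)" for j
  have lip: "dist (\<Psi> x) (\<Psi> x') \<le> dist x x'" if "x \<in> piece B p i c" "x' \<in> piece B p i c" for x x'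
    unfolding dist_norm
  proof (rule norm_le_componentwise_cart)
    fix l
    obtain y y' where y: "x $ l = mix B y" "x' $ l = mix B y'" using \<open>x \<in> _\<close> \<open>x' \<in> _\<close> by (auto simp: piece_def)
    have "\<bar>partial_mix B p y - partial_mix B p y'\<bar> \<le> \<bar>mix B y - mix B y'\<bar>"
      using partial_mix_increment[OF B, of y y' p] partial_mix_increment[OF B, of y' y p] by linarith
    then show "norm ((\<Psi> x - \<Psi> x') $ l) \<le> norm ((x - x') $ l)" by (simp add: \<Psi>_def y S)
  qed
  have X: "bounded (X j)" "hausdorff_weight (real CARD('n) - 1) (X j) \<le> hausdorff_weight (real CARD('n) - 1) (C j)" for j
    unfolding X_def using hausdorff_weight_lipschitz_image[of "C j" "C j \<inter> piece B p i c" "real CARD('n) - 1" \<Psi>] lip bdd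
    by (simp_all add: Suc_leI)
  have "(\<Pi>\<^sub>E j\<in>-{i}. {0..v}) \<subseteq> (\<Union>j. hyperplane_trace i (X j))"
  proof
    fix b assume b: "b \<in> (\<Pi>\<^sub>E j\<in>-{i}. {0..v})"
    have "\<exists>z\<in>carrier_set B p. partial_mix B p z = b j" if "j \<noteq> i" for j
      using b that by (intro partial_mix_onto[OF B p]) (auto simp: PiE_iff v_def)
    then obtain z where z: "\<And>j. j \<noteq> i \<Longrightarrow> z j \<in> carrier_set B p \<and> partial_mix B p (z j) = b j" by metis
    \<comment> \<open>The \<open>i\<close>-th parameter is free, so it can be used to meet the sum condition.\<close>
    define y where "y = z(i := c - (\<Sum>j\<in>-{i}. z j))"
    have "(\<Sum>j\<in>UNIV. y j) = y i + (\<Sum>j\<in>-{i}. y j)"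
      by (subst sum.remove[of _ i]) (auto simp: Compl_eq_Diff_UNIV)
    also have "(\<Sum>j\<in>-{i}. y j) = (\<Sum>j\<in>-{i}. z j)" by (intro sum.cong) (auto simp: y_def)
    finally have sum: "(\<Sum>j\<in>UNIV. y j) = c" by (simp add: y_def)
    let ?x = "\<chi> j. mix B (y j)"
    have x: "?x \<in> piece B p i c" using z sum unfolding piece_def
      by (intro CollectI exI[of _ y]) (auto simp: y_def)
    then obtain j where "?x \<in> C j" using cov by blast
    then have "\<Psi> ?x \<in> X j" using x by (auto simp: X_def)
    moreover have "\<Psi> ?x = hyperplane_point i b"
      using z by (auto simp: \<Psi>_def hyperplane_point_def S y_def vec_eq_iff)
    ultimately have "hyperplane_point i b \<in> closure (X j)" using closure_subset by fastforce
    then show "b \<in> (\<Union>j. hyperplane_trace i (X j))"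
      using b by (intro UN_I[of j]) (auto simp: hyperplane_trace_def space_PiM PiE_iff)
  qed
  then have "emeasure ?M (\<Pi>\<^sub>E j\<in>-{i}. {0..v}) \<le> emeasure ?M (\<Union>j. hyperplane_trace i (X j))"
    by (intro emeasure_mono sets.countable_UN) (auto simp: hyperplane_trace_measurable)
  also have "\<dots> \<le> (\<Sum>j. emeasure ?M (hyperplane_trace i (X j)))"
    by (intro emeasure_subadditive_countably) (auto simp: hyperplane_trace_measurable)
  also have "\<dots> \<le> (\<Sum>j. hausdorff_weight (real CARD('n) - 1) (C j))"
    by (intro suminf_le order_trans[OF isodiametric_hyperplane[OF X(1)] X(2)]) auto
  finally have "emeasure ?M (\<Pi>\<^sub>E j\<in>-{i}. {0..v}) \<le> (\<Sum>j. hausdorff_weight (real CARD('n) - 1) (C j))" .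
  also have "emeasure ?M (\<Pi>\<^sub>E j\<in>-{i}. {0..v}) = (\<Prod>j\<in>-{i}. emeasure lborel {0..v})"
    by (rule emeasure_PiM) auto
  also have "\<dots> = ennreal (v ^ (CARD('n) - 1))"
    using v by (simp add: ennreal_power card_Diff_singleton Compl_eq_Diff_UNIV)
  finally show ?thesis by (simp add: v_def)
qed

section \<open>Truncation to the exact measure\<close>

lemma infinite_non_sumset_values:
  fixes N :: "'n :: finite itself"
  assumes B: "B = real CARD('n) + 2"
  shows "infinite (- (\<Union>p. sumset N (carrier_set B p)))"
proof
  let ?bad = "\<Union>p. sumset N (carrier_set B p)"
  assume "finite (- ?bad)"
  then have "negligible (- ?bad \<union> ?bad)"
    by (intro negligible_Un negligible_finite negligible_sumset_carrier_set B)
  then show False using non_negligible_UNIV[where 'a=real] by (simp only: Compl_partition2)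
qed

text \<open>For every \<open>p\<close> there are \<open>n\<close> pieces for each value \<open>c\<close>, all of them disjoint and each of measure
at least \<open>(1 - 2\<^sup>-\<^sup>p)\<^sup>n\<^sup>-\<^sup>1\<close>; let \<open>p\<close> tend to infinity.\<close>
lemma hausdorff_measure_level_sets_ge:
  fixes cs :: "real set" and N :: "'n :: finite itself"
  assumes B: "B > 2" and cs: "finite cs" "cs \<subseteq> - (\<Union>p. sumset N (carrier_set B p))"
  shows "ennreal (real (card cs * CARD('n))) \<le> hausdorff_measure (real CARD('n) - 1) (\<Union>c\<in>cs. level_set B c :: (real ^ 'n) set)"
proof -
  let ?H = "hausdorff_measure (real CARD('n) - 1) (\<Union>c\<in>cs. level_set B c :: (real ^ 'n) set)"
  let ?v = "\<lambda>p. (1 - (1/2) ^ p :: real) ^ (CARD('n) - 1)"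
  have bound: "ennreal (real (card cs * CARD('n)) * ?v p) \<le> ?H" if p: "p > 0" for p
  proof -
    have "of_nat (card (cs \<times> (UNIV :: 'n set))) * ennreal (?v p) \<le>
        hausdorff_measure (real CARD('n) - 1) (\<Union>ci\<in>cs \<times> UNIV. piece B p (snd ci) (fst ci) :: (real ^ 'n) set)"
    proof (rule hausdorff_measure_separated_ge)
      show "finite (cs \<times> (UNIV :: 'n set))" using cs by simp
      show "disjoint_family_on (\<lambda>ci. piece B p (snd ci) (fst ci) :: (real ^ 'n) set) (cs \<times> UNIV)"
        unfolding disjoint_family_on_def
      proof (intro ballI impI)
        fix ci ci' :: "real \<times> 'n"
        assume ci: "ci \<in> cs \<times> UNIV" "ci \<noteq> ci'"
        have "fst ci \<notin> sumset N (carrier_set B p)" using ci cs(2) by auto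
        from pieces_disjoint[OF B _ this, of "snd ci" "fst ci'" "snd ci'"] ci(2)
        show "piece B p (snd ci) (fst ci) \<inter> piece B p (snd ci') (fst ci') = ({} :: (real ^ 'n) set)"
          by simp
      qed
    qed (intro compact_piece[OF B p] piece_cover_ge[OF B p]; assumption)+
    also have "\<dots> \<le> ?H" 
      by (rule hausdorff_measure_mono, rule UN_least, rule order_trans[OF piece_subset_level_set], rule UN_upper) auto
    also have "of_nat (card (cs \<times> (UNIV :: 'n set))) * ennreal (?v p) = ennreal (real (card cs * CARD('n)) * ?v p)"
      by (simp add: card_cartesian_product ennreal_mult' ennreal_of_nat_eq_real_of_nat power_le_one)
    finally show ?thesis .
  qed
  have half: "(\<lambda>p. (1/2::real) ^ p) \<longlonglongrightarrow> 0" by (intro LIMSEQ_power_zero) simp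
  have "(\<lambda>p. ennreal (real (card cs * CARD('n)) * ?v p)) \<longlonglongrightarrow>
      ennreal (real (card cs * CARD('n)) * (1 - 0) ^ (CARD('n) - 1))"
    by (intro tendsto_ennrealI tendsto_mult tendsto_const tendsto_power tendsto_diff half)
  then have "ennreal (real (card cs * CARD('n)) * (1 - 0) ^ (CARD('n) - 1)) \<le> ?H"
    by (rule tendsto_upperbound) (rule eventually_sequentiallyI[of 1], rule bound, simp_all)
  then show ?thesis by simp
qed

text \<open>The intermediate value theorem for extended nonnegative functions with bounded growth, which are finite
everywhere once they vanish somewhere.\<close>
lemma lipschitz_truncation_attains:
  fixes f :: "real \<Rightarrow> ennreal"
  assumes st: "a \<le> b" and a: "f a = 0" and v: "ennreal v \<le> f b" "v \<ge> 0"
    and L: "\<And>s t. s < t \<Longrightarrow> f t \<le> f s + ennreal (L * (t - s))"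
    and mono: "\<And>s t. s \<le> t \<Longrightarrow> f s \<le> f t" and L0: "L \<ge> 0"
  shows "\<exists>t. f t = ennreal v"
proof -
  have fin: "f t < top" for t
  proof (cases "a < t")
    case True
    then show ?thesis using L[of a t] a by (simp add: le_less_trans)
  next
    case False
    then show ?thesis using mono[of t a] a by simp
  qed
  define g where "g t = enn2real (f t)" for t
  have f: "f t = ennreal (g t)" "g t \<ge> 0" for t using fin[of t] by (auto simp: g_def)
  have inc: "0 \<le> g t - g s \<and> g t - g s \<le> L * (t - s)" if "s \<le> t" for s t
  proof (cases "s = t")
    case False
    then have "ennreal (g t) \<le> ennreal (g s + L * (t - s))"
      using L[of s t] that f(2) L0 by (simp add: f(1)[symmetric] ennreal_plus)
    then have "g t \<le> g s + L * (t - s)" using that f(2)[of s] L0 by (subst (asm) ennreal_le_iff) auto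
    moreover have "g s \<le> g t" using mono[OF that] f by simp
    ultimately show ?thesis by simp
  qed simp
  have "L-lipschitz_on UNIV g"
  proof (rule lipschitz_onI[OF _ L0])
    fix s t :: real
    show "dist (g s) (g t) \<le> L * dist s t"
      using inc[of s t] inc[of t s] by (cases "s \<le> t") (auto simp: dist_real_def abs_if)
  qed
  then have "continuous_on {a..b} g"
    by (rule continuous_on_subset[OF lipschitz_on_continuous_on]) simp
  moreover have "g a \<le> v" using a v(2) by (simp add: g_def)
  moreover have "v \<le> g b" using v(1) unfolding f(1)[of b] ennreal_le_iff[OF f(2)] .
  ultimately obtain t where "g t = v" using IVT'[of g a v b] st by auto
  then show ?thesis using f(1)[of t] by auto
qed

lemma exists_k_antichain_dim_ge_2:
  assumes n: "CARD('n) \<ge> 2"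
  shows "\<exists>A :: (real ^ 'n) set. k_antichain k {0..1} A \<and>
           hausdorff_measure (real CARD('n) - 1) A = of_nat (k * CARD('n))"
proof -
  define B where "B = real CARD('n) + 2"
  have B: "B > 2" by (simp add: B_def)
  let ?s = "real CARD('n) - 1"
  define K where "K = unit_ball_vol ?s * (3 * real CARD('n)) ^ (CARD('n) - 1)"
  have K: "K \<ge> 0" using n by (simp add: K_def)
  obtain a b :: 'n where ab: "a \<noteq> b"
  proof -
    have "\<not> card (UNIV :: 'n set) \<le> Suc 0" using n by simp
    then show ?thesis using that unfolding card_le_Suc0_iff_eq[OF finite] by blast
  qed
  obtain cs where cs: "finite cs" "card cs = k" "cs \<subseteq> - (\<Union>p. sumset TYPE('n) (carrier_set B p))"
    using infinite_arbitrarily_large[OF infinite_non_sumset_values[OF B_def]] by blast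
  define A :: "(real ^ 'n) set" where "A = (\<Union>c\<in>cs. level_set B c)"
  define T where "T t = A \<inter> {x. x $ a - x $ b \<le> t}" for t
  have cube: "A \<subseteq> {0..1}" using level_set_subset_cube[OF B] by (auto simp: A_def)
  have diff: "-1 \<le> x $ a - x $ b" "x $ a - x $ b \<le> 1" if "x \<in> A" for x
  proof -
    have "0 \<le> x $ j \<and> x $ j \<le> 1" for j using cube that by (auto simp: less_eq_vec_def subset_iff)
    from this[of a] this[of b] show "-1 \<le> x $ a - x $ b" "x $ a - x $ b \<le> 1" by linarith+
  qed
  have "\<exists>t. hausdorff_measure ?s (T t) = ennreal (real (k * CARD('n)))"
  \<comment> \<open>On the cube the difference of two coordinates lies in \<open>[-1, 1]\<close>: nothing is left at \<open>-2\<close>, and all of \<open>A\<close> at \<open>1\<close>.\<close>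
  proof (rule lipschitz_truncation_attains[where a="-2" and b=1])
    have "T (-2) = {}" using diff(1) by (force simp: T_def)
    then show "hausdorff_measure ?s (T (-2)) = 0"
      using hausdorff_measure_finite_UN_le[of "{} :: nat set" ?s "\<lambda>_. {}"] by simp
    have "T 1 = A" using diff(2) by (auto simp: T_def)
    then show "ennreal (real (k * CARD('n))) \<le> hausdorff_measure ?s (T 1)"
      using hausdorff_measure_level_sets_ge[OF B cs(1,3)] by (simp add: A_def cs(2))
    show "hausdorff_measure ?s (T s) \<le> hausdorff_measure ?s (T t)" if "s \<le> t" for s t
      using that by (intro hausdorff_measure_mono) (auto simp: T_def)
    show "0 \<le> real k * K" using K by simp
    show "hausdorff_measure ?s (T t) \<le> hausdorff_measure ?s (T s) + ennreal (real k * K * (t - s))" if st: "s < t" for s t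
    proof -
      let ?slab = "{x :: real ^ 'n. s < x $ a - x $ b \<and> x $ a - x $ b \<le> t}"
      have "T t \<subseteq> T s \<union> (\<Union>c\<in>cs. level_set B c \<inter> ?slab)" by (auto simp: T_def A_def)
      then have "hausdorff_measure ?s (T t) \<le>
          hausdorff_measure ?s (T s) + hausdorff_measure ?s (\<Union>c\<in>cs. level_set B c \<inter> ?slab)"
        by (rule order_trans[OF hausdorff_measure_mono hausdorff_measure_Un_le])
      also have "hausdorff_measure ?s (\<Union>c\<in>cs. level_set B c \<inter> ?slab) \<le>
          (\<Sum>c\<in>cs. hausdorff_measure ?s (level_set B c \<inter> ?slab))"
        by (rule hausdorff_measure_finite_UN_le[OF cs(1)])
      also have "\<dots> \<le> (\<Sum>c\<in>cs. ennreal (K * (t - s)))"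
        unfolding K_def
        by (intro sum_mono hausdorff_measure_antichain_slab_le[OF ab level_set_subset_cube[OF B] st]
              level_set_not_strictly_below[OF B])
      also have "\<dots> = ennreal (real k * K * (t - s))"
        using K st by (simp add: cs(2) ennreal_of_nat_eq_real_of_nat ennreal_mult'[symmetric] mult.assoc)
      finally show ?thesis by (simp add: add_left_mono)
    qed
  qed auto
  then obtain t where t: "hausdorff_measure ?s (T t) = ennreal (real (k * CARD('n)))" by blast
  have "k_antichain k {0..1} (T t)"
    by (rule k_antichain_Union_level_sets[OF B cs(1,2)]) (auto simp: T_def A_def)
  then show ?thesis using t by (intro exI[of _ "T t"]) (simp add: ennreal_of_nat_eq_real_of_nat)
qed

lemma hausdorff_measure_0_finite:
  fixes A :: "'a::heine_borel set"
  assumes A: "finite A"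
  shows "hausdorff_measure 0 A = of_nat (card A)"
proof (rule antisym)
  have w: "hausdorff_weight 0 C = 1" if "C \<noteq> {}" for C :: "'a set"
    using that by (simp add: hausdorff_weight_def)
  have "hausdorff_measure 0 A \<le> of_nat (card A) * 1"
    by (intro hausdorff_measure_least hausdorff_pre_le_finite_cover[OF A, where D="\<lambda>x. {x}"]) (auto simp: w)
  then show "hausdorff_measure 0 A \<le> of_nat (card A)" by simp
  have "of_nat (card A) * 1 \<le> hausdorff_measure 0 (\<Union>x\<in>A. {x})"
  proof (rule hausdorff_measure_separated_ge[OF A])
    fix x :: 'a and C assume "{x} \<subseteq> (\<Union>j::nat. C j)"
    then obtain j where "x \<in> C j" by blast
    then have "1 = (\<Sum>j\<in>{j}. hausdorff_weight 0 (C j))" using w[of "C j"] by auto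
    also have "\<dots> \<le> (\<Sum>j. hausdorff_weight 0 (C j))" by (intro sum_le_suminf) auto
    finally show "1 \<le> (\<Sum>j. hausdorff_weight 0 (C j))" .
  qed (auto simp: disjoint_family_on_def)
  then show "of_nat (card A) \<le> hausdorff_measure 0 A" by simp
qed

lemma exists_k_antichain_dim_1:
  assumes n: "CARD('n) = 1"
  shows "\<exists>A :: (real ^ 'n) set. k_antichain k {0..1} A \<and>
           hausdorff_measure (real CARD('n) - 1) A = of_nat (k * CARD('n))"
proof -
  have "infinite {0..1::real}" by (simp add: infinite_Icc)
  then obtain V where V: "finite V" "card V = k" "V \<subseteq> {0..1::real}"
    using infinite_arbitrarily_large by blast
  define A :: "(real ^ 'n) set" where "A = (\<lambda>v. \<chi> j. v) ` V"
  have A: "finite A" "card A = k" "A \<subseteq> {0..1}"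
  proof -
    show "finite A" using V by (simp add: A_def)
    have "inj_on (\<lambda>v. \<chi> j. v :: real ^ 'n) V" by (auto simp: inj_on_def vec_eq_iff)
    then show "card A = k" using V by (simp add: A_def card_image)
    show "A \<subseteq> {0..1}" using V by (auto simp: A_def less_eq_vec_def)
  qed
  then have "k_antichain k {0..1} A"
    by (auto simp: k_antichain_def intro: order_trans[OF card_mono[of A]])
  then show ?thesis using A hausdorff_measure_0_finite[OF A(1)] by (intro exI[of _ A]) (simp add: n)
qed

theorem theorem1:
  fixes k :: nat
  assumes "k \<ge> 1"
  shows "\<exists>A :: (real ^ 'n) set. k_antichain k {0..1} A \<and>
           hausdorff_measure (real CARD('n) - 1) A = of_nat (k * CARD('n))"
proof (cases "CARD('n) = 1")
  case True
  then show ?thesis by (rule exists_k_antichain_dim_1)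
next
  case False
  moreover have "CARD('n) > 0" by simp
  ultimately have "CARD('n) \<ge> 2" by linarith
  then show ?thesis by (rule exists_k_antichain_dim_ge_2)
qed

end
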